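(* Let $|\varphi\rangle$ be the normalized three-qubit state proportional to $|H_0\rangle^{\otimes 3} + |H_1\rangle^{\otimes 3}$. Then $|\varphi\rangle \nrightarrow_D |H_0\rangle$, but $|\varphi\rangle\otimes|H_0\rangle \rightarrow_D |H_0\rangle\otimes|H_0\rangle$.
   Context: $X,Y,Z$ are the single-qubit Pauli matrices and $H=(X+Z)/\sqrt2$ is the Hadamard gate. $|H_0\rangle=\cos(\pi/8)|0\rangle+\sin(\pi/8)|1\rangle$ is the $+1$ eigenstate of $H$, and $|H_1\rangle = Y|H_0\rangle$ is its $-1$ eigenstate. The Clifford group on $n$ qubits is the group of unitaries $C$ such that $CpC^\dagger$ is a Pauli operator (a tensor product of $1,X,Y,Z$, up to sign) for every Pauli operator $p$. A pure stabilizer state on $n$ qubits is the unique (up to phase) common $+1$ eigenvector of $n$ commuting, independent signed Pauli operators; a (mixed) stabilizer state is a convex mixture of pure stabilizer states. A Clifford computer is a device capable of performing ideal Clifford unitaries, preparation of stabilizer states, classical feedforward (later operations may depend on earlier classical outcomes), classical randomness, and Pauli measurements; qubits may be discarded (partial trace). We write $\rho\rightarrow_D\rho'$ if a Clifford computer can take the input state $\rho$ and deterministically (with probability one) output the state $\rho'$, and $\rho\nrightarrow_D\rho'$ if it cannot. Pure states are identified with their rank-one projectors (so global phases are irrelevant). *)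

theory Defs
  imports Complex_Main "Jordan_Normal_Form.Schur_Decomposition"
begin

(* An n-qubit state vector is an element of carrier_vec (2^n), an n-qubit operator an element of
   carrier_mat (2^n) (2^n). The computational basis is ordered lexicographically: the first tensor
   factor is the most significant bit of the index. *)

definition tensor_mat :: "complex mat \<Rightarrow> complex mat \<Rightarrow> complex mat" where
  "tensor_mat A B = mat (dim_row A * dim_row B) (dim_col A * dim_col B)
     (\<lambda>(i, j). A $$ (i div dim_row B, j div dim_col B) * B $$ (i mod dim_row B, j mod dim_col B))"

definition tensor_vec :: "complex vec \<Rightarrow> complex vec \<Rightarrow> complex vec" where
  "tensor_vec v w = vec (dim_vec v * dim_vec w)
     (\<lambda>i. v $ (i div dim_vec w) * w $ (i mod dim_vec w))"

definition proj :: "complex vec \<Rightarrow> complex mat" where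
  "proj v = mat (dim_vec v) (dim_vec v) (\<lambda>(i, j). v $ i * cnj (v $ j))"

definition normalized :: "complex vec \<Rightarrow> bool" where
  "normalized v \<longleftrightarrow> v \<bullet>c v = 1"

definition normalize_vec :: "complex vec \<Rightarrow> complex vec" where
  "normalize_vec v = complex_of_real (1 / sqrt (Re (v \<bullet>c v))) \<cdot>\<^sub>v v"

(* Partial trace over the last k of n + k qubits. *)
definition partial_trace :: "nat \<Rightarrow> nat \<Rightarrow> complex mat \<Rightarrow> complex mat" where
  "partial_trace n k \<rho> = mat (2^n) (2^n) (\<lambda>(i, j). \<Sum>l<2^k. \<rho> $$ (i * 2^k + l, j * 2^k + l))"

definition pauli_X :: "complex mat" where
  "pauli_X = mat_of_rows_list 2 [[0, 1], [1, 0]]"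

definition pauli_Y :: "complex mat" where
  "pauli_Y = mat_of_rows_list 2 [[0, - \<i>], [\<i>, 0]]"

definition pauli_Z :: "complex mat" where
  "pauli_Z = mat_of_rows_list 2 [[1, 0], [0, - 1]]"

definition paulis :: "nat \<Rightarrow> complex mat set" where
  "paulis n = {s \<cdot>\<^sub>m foldr tensor_mat ps (1\<^sub>m 1) | s ps.
     s \<in> {1, - 1} \<and> length ps = n \<and> set ps \<subseteq> {1\<^sub>m 2, pauli_X, pauli_Y, pauli_Z}}"

definition unitary_mat :: "nat \<Rightarrow> complex mat \<Rightarrow> bool" where
  "unitary_mat d U \<longleftrightarrow> U \<in> carrier_mat d d \<and> U * mat_adjoint U = 1\<^sub>m d \<and> mat_adjoint U * U = 1\<^sub>m d"

definition clifford_group :: "nat \<Rightarrow> complex mat set" where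
  "clifford_group n =
     {C. unitary_mat (2^n) C \<and> (\<forall>P \<in> paulis n. C * P * mat_adjoint C \<in> paulis n)}"

(* Independence as elements of the Pauli group modulo signs: no product over a nonempty
   subfamily is trivial. *)
definition independent_paulis :: "nat \<Rightarrow> complex mat list \<Rightarrow> bool" where
  "independent_paulis n gs \<longleftrightarrow> (\<forall>I \<subseteq> {..<length gs}. I \<noteq> {} \<longrightarrow>
     foldr (*) (nths gs I) (1\<^sub>m (2^n)) \<notin> {1\<^sub>m (2^n), - 1\<^sub>m (2^n)})"

definition pure_stabilizer :: "nat \<Rightarrow> complex vec \<Rightarrow> bool" where
  "pure_stabilizer n v \<longleftrightarrow> v \<in> carrier_vec (2^n) \<and> normalized v \<and>
     (\<exists>gs. length gs = n \<and> set gs \<subseteq> paulis n \<and>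
        (\<forall>g \<in> set gs. \<forall>h \<in> set gs. g * h = h * g) \<and> independent_paulis n gs \<and>
        (\<forall>g \<in> set gs. g *\<^sub>v v = v) \<and>
        (\<forall>w \<in> carrier_vec (2^n). normalized w \<and> (\<forall>g \<in> set gs. g *\<^sub>v w = w) \<longrightarrow>
           (\<exists>c. cmod c = 1 \<and> w = c \<cdot>\<^sub>v v)))"

definition stabilizer_state :: "nat \<Rightarrow> complex mat \<Rightarrow> bool" where
  "stabilizer_state n \<sigma> \<longleftrightarrow> (\<exists>(k::nat) (p :: nat \<Rightarrow> real) (v :: nat \<Rightarrow> complex vec).
     (\<forall>l<k. 0 \<le> p l \<and> pure_stabilizer n (v l)) \<and> (\<Sum>l<k. p l) = 1 \<and>
     \<sigma> = mat (2^n) (2^n) (\<lambda>(i, j). \<Sum>l<k. complex_of_real (p l) * proj (v l) $$ (i, j)))"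

(* Projector onto the eigenspace of the Pauli P with eigenvalue s = 1 or s = -1. *)
definition pauli_projector :: "nat \<Rightarrow> complex mat \<Rightarrow> complex \<Rightarrow> complex mat" where
  "pauli_projector n P s = (1 / 2) \<cdot>\<^sub>m (1\<^sub>m (2^n) + s \<cdot>\<^sub>m P)"

(* clifford_protocol n m E: E is the map on n-qubit states realised by a finite adaptive protocol of
   a Clifford computer that outputs m qubits. Each rule prepends one step to the protocols carrying
   out the rest of the computation. In rule measure the continuations E1 and E2 are chosen
   independently for the two outcomes, which is the classical feedforward; the post-measurement
   states are left unnormalised, so their traces carry the outcome probabilities. Every outcome
   branch ends with an output of m qubits (there is no postselection and no failure), and E adds up
   all branches. Only the last qubits are discarded and new ones are appended at the end; this is no
   restriction since permutations of qubits are Clifford unitaries. *)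
inductive clifford_protocol :: "nat \<Rightarrow> nat \<Rightarrow> (complex mat \<Rightarrow> complex mat) \<Rightarrow> bool" where
  finish: "clifford_protocol n n (\<lambda>\<rho>. \<rho>)"
| unitary: "C \<in> clifford_group n \<Longrightarrow> clifford_protocol n m E \<Longrightarrow>
    clifford_protocol n m (\<lambda>\<rho>. E (C * \<rho> * mat_adjoint C))"
| prepare: "stabilizer_state k \<sigma> \<Longrightarrow> clifford_protocol (n + k) m E \<Longrightarrow>
    clifford_protocol n m (\<lambda>\<rho>. E (tensor_mat \<rho> \<sigma>))"
| discard: "clifford_protocol n m E \<Longrightarrow>
    clifford_protocol (n + k) m (\<lambda>\<rho>. E (partial_trace n k \<rho>))"
| measure: "P \<in> paulis n \<Longrightarrow> clifford_protocol n m E1 \<Longrightarrow> clifford_protocol n m E2 \<Longrightarrow>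
    clifford_protocol n m (\<lambda>\<rho>.
      E1 (pauli_projector n P 1 * \<rho> * pauli_projector n P 1) +
      E2 (pauli_projector n P (- 1) * \<rho> * pauli_projector n P (- 1)))"
| randomize: "0 \<le> p \<Longrightarrow> p \<le> 1 \<Longrightarrow> clifford_protocol n m E1 \<Longrightarrow> clifford_protocol n m E2 \<Longrightarrow>
    clifford_protocol n m (\<lambda>\<rho>.
      complex_of_real p \<cdot>\<^sub>m E1 \<rho> + complex_of_real (1 - p) \<cdot>\<^sub>m E2 \<rho>)"

(* The relation \<rho> \<rightarrow>_D \<rho>' for an n-qubit state \<rho> and an m-qubit state \<rho>'. If \<rho>' is pure, the
   equation says that every branch of nonzero probability outputs \<rho>'. *)
definition det_converts :: "nat \<Rightarrow> nat \<Rightarrow> complex mat \<Rightarrow> complex mat \<Rightarrow> bool" where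
  "det_converts n m \<rho> \<rho>' \<longleftrightarrow> (\<exists>E. clifford_protocol n m E \<and> E \<rho> = \<rho>')"

definition ket_H0 :: "complex vec" where
  "ket_H0 = vec_of_list [complex_of_real (cos (pi / 8)), complex_of_real (sin (pi / 8))]"

definition ket_H1 :: "complex vec" where
  "ket_H1 = pauli_Y *\<^sub>v ket_H0"

definition ket_phi :: "complex vec" where
  "ket_phi = normalize_vec
     (tensor_vec ket_H0 (tensor_vec ket_H0 ket_H0) + tensor_vec ket_H1 (tensor_vec ket_H1 ket_H1))"

end

theory Submission
  imports Defs
begin

text \<open>The amplitudes of \<^const>\<open>ket_phi\<close> are Gaussian rationals up to a global phase, so the entries of
  its projector lie in \<open>\<rat>(\<i>)\<close>. Along every branch of a protocol this field is preserved: the Pauli operators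
  span all matrices over it, Clifford conjugation permutes them up to signs, and the projector of a pure
  stabilizer state is the product of the projectors \<open>(1 + g) / 2\<close> of its generators. A branch of nonzero
  probability with output \<^const>\<open>ket_H0\<close> would thus force \<open>\<surd>2\<close>, the ratio of the trace to the
  difference of the diagonal entries, to be rational.

  With a copy of \<^const>\<open>ket_H0\<close> as the fourth qubit, measure \<open>Y \<otimes> Y\<close> on the last two qubits. On the
  eigenspace of the outcome \<open>H \<otimes> H\<close> acts as a Pauli operator, and measuring that one tells whether the first two
  qubits are both in the state \<^const>\<open>ket_H0\<close> or both in \<^const>\<open>ket_H1\<close>; the operator \<open>Y \<otimes> Y\<close> exchanges the
  two cases.\<close>

text \<open>Tensor signs are omitted below. Why sqrt 2 drops out of \<open>ket_phi\<close>: the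
  state is the common +1 eigenvector of H H 1, 1 H H and Y Y Y, and H H = (X + Z) (X + Z) / 2 has
  rational entries, so the product of the corresponding projectors has entries in Q(i). A single H
  has no partner that cancels its sqrt 2. Rationality cannot be demanded of the total state, because
  the weights of mixtures and random choices are arbitrary reals, nor of a Clifford matrix, because
  its entries may leave Q(i). Hence branches are followed one by one, with pure preparations, and
  only the conjugation action of a Clifford matrix enters. Positivity links the sum of the branches
  to each of them: all that is used of the output is its orthogonality to \<open>ket_H1\<close>. The
  catalyst helps because Y anticommutes with H. So Y Y commutes with H H, and measuring it does not
  disturb the parity that marks the two terms of the superposition; measuring H on the third qubit
  alone would not be a Pauli measurement.\<close>

lemma mat_adjoint_carrier [simp]:
  "A \<in> carrier_mat n m \<Longrightarrow> mat_adjoint A \<in> carrier_mat m n"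
  unfolding mat_adjoint_def by auto

lemma mat_adjoint_dim [simp]:
  "dim_row (mat_adjoint A) = dim_col A" "dim_col (mat_adjoint A) = dim_row A"
  unfolding mat_adjoint_def by auto

lemma mat_adjoint_index [simp]:
  fixes A :: "complex mat"
  shows "i < dim_col A \<Longrightarrow> j < dim_row A \<Longrightarrow> mat_adjoint A $$ (i, j) = cnj (A $$ (j, i))"
  unfolding mat_adjoint_def by (simp add: mat_of_rows_index)

lemma mult_mat_index_sum:
  assumes "A \<in> carrier_mat n m" "B \<in> carrier_mat m k" "i < n" "j < k"
  shows "(A * B) $$ (i, j) = (\<Sum>l<m. A $$ (i, l) * B $$ (l, j))"
  using assms by (auto simp: scalar_prod_def atLeast0LessThan)

lemma mat_adjoint_mult:
  fixes A B :: "complex mat"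
  assumes A: "A \<in> carrier_mat n m" and B: "B \<in> carrier_mat m k"
  shows "mat_adjoint (A * B) = mat_adjoint B * mat_adjoint A"
proof (rule eq_matI)
  fix i j assume "i < dim_row (mat_adjoint B * mat_adjoint A)" "j < dim_col (mat_adjoint B * mat_adjoint A)"
  then have ij: "i < k" "j < n" using A B by auto
  show "mat_adjoint (A * B) $$ (i, j) = (mat_adjoint B * mat_adjoint A) $$ (i, j)"
    unfolding mult_mat_index_sum[OF mat_adjoint_carrier[OF B] mat_adjoint_carrier[OF A] ij]
    using A B ij mult_mat_index_sum[OF A B ij(2,1)] by (simp add: mult.commute del: index_mult_mat(1))
qed (use A B in auto)

lemma mult_mat_vec_index_sum:
  assumes "A \<in> carrier_mat n m" "v \<in> carrier_vec m" "i < n"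
  shows "(A *\<^sub>v v) $ i = (\<Sum>l<m. A $$ (i, l) * v $ l)"
  using assms by (auto simp: scalar_prod_def atLeast0LessThan)

lemma cscalar_prod_sum:
  fixes v w :: "complex vec"
  assumes "v \<in> carrier_vec n" "w \<in> carrier_vec n"
  shows "v \<bullet>c w = (\<Sum>i<n. v $ i * cnj (w $ i))"
  using assms by (auto simp: scalar_prod_def atLeast0LessThan)

lemma sum_lessThan_2: "(\<Sum>i<2. f i) = f 0 + f (Suc 0)"
  by (simp add: numeral_2_eq_2)

lemma sum_lessThan_mult:
  fixes f :: "nat \<Rightarrow> 'a::comm_monoid_add"
  shows "(\<Sum>i<N * K. f i) = (\<Sum>a<N. \<Sum>b<K. f (a * K + b))"
proof -
  have "(\<Sum>i<N * K. f i) = (\<Sum>a<N. sum f {a * K..<a * K + K})"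
    by (simp add: sum.nat_group)
  also have "\<dots> = (\<Sum>a<N. \<Sum>b<K. f (a * K + b))"
  proof (rule sum.cong[OF refl])
    fix a :: nat
    show "sum f {a * K..<a * K + K} = (\<Sum>b<K. f (a * K + b))"
      by (rule sum.reindex_bij_witness[of _ "\<lambda>b. a * K + b" "\<lambda>b. b - a * K"]) auto
  qed
  finally show ?thesis .
qed

lemma mult_add_less: "a < N \<Longrightarrow> b < K \<Longrightarrow> a * K + b < N * (K::nat)"
proof -
  assume "a < N" "b < K"
  then have "a * K + b < Suc a * K" by simp
  also have "\<dots> \<le> N * K" using \<open>a < N\<close> by (intro mult_le_mono1) simp
  finally show ?thesis .
qed

lemma less_mult_div_mod:
  assumes "i < N * (K::nat)" shows "i div K < N" "i mod K < K"
  using assms by (auto simp: less_mult_imp_div_less intro!: mod_less_divisor gr0I)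

lemma mat_mult_cscalar_prod:
  fixes K :: "complex mat"
  assumes "K \<in> carrier_mat n m" "x \<in> carrier_vec m" "u \<in> carrier_vec n"
  shows "(K *\<^sub>v x) \<bullet>c u = x \<bullet>c (mat_adjoint K *\<^sub>v u)"
proof -
  have "(K *\<^sub>v x) \<bullet>c u = (\<Sum>i<n. (\<Sum>j<m. K $$ (i, j) * x $ j) * cnj (u $ i))"
    using assms by (subst cscalar_prod_sum[of _ n]) (auto simp: mult_mat_vec_index_sum[OF assms(1,2)] simp del: index_mult_mat_vec)
  also have "\<dots> = (\<Sum>j<m. \<Sum>i<n. K $$ (i, j) * x $ j * cnj (u $ i))"
    by (subst sum.swap) (simp add: sum_distrib_right)
  also have "\<dots> = (\<Sum>j<m. x $ j * cnj (\<Sum>i<n. mat_adjoint K $$ (j, i) * u $ i))"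
    using assms by (auto simp: sum_distrib_left mult_ac intro!: sum.cong)
  also have "\<dots> = x \<bullet>c (mat_adjoint K *\<^sub>v u)"
    using assms by (subst cscalar_prod_sum[of _ m]) 
      (auto simp: mult_mat_vec_index_sum[OF mat_adjoint_carrier[OF assms(1)] assms(3)] 
        simp del: index_mult_mat_vec intro!: mult_mat_vec_carrier[OF mat_adjoint_carrier])
  finally show ?thesis .
qed

lemma proj_carrier [simp]: "v \<in> carrier_vec n \<Longrightarrow> proj v \<in> carrier_mat n n"
  by (auto simp: proj_def)

lemma proj_index [simp]:
  "i < dim_vec v \<Longrightarrow> j < dim_vec v \<Longrightarrow> proj v $$ (i, j) = v $ i * cnj (v $ j)"
  by (simp add: proj_def)

lemma proj_mult_vec:
  assumes "v \<in> carrier_vec n" "u \<in> carrier_vec n"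
  shows "proj v *\<^sub>v u = (u \<bullet>c v) \<cdot>\<^sub>v v"
proof (rule eq_vecI)
  fix i assume "i < dim_vec ((u \<bullet>c v) \<cdot>\<^sub>v v)"
  then have i: "i < n" using assms by simp
  have "(proj v *\<^sub>v u) $ i = (\<Sum>l<n. v $ i * cnj (v $ l) * u $ l)"
    using assms i by (subst mult_mat_vec_index_sum[of _ n n]) auto
  also have "\<dots> = (u \<bullet>c v) * v $ i"
    using assms by (simp add: cscalar_prod_sum[of _ n] sum_distrib_left mult_ac)
  finally show "(proj v *\<^sub>v u) $ i = ((u \<bullet>c v) \<cdot>\<^sub>v v) $ i" using assms i by simp
qed (use assms in \<open>auto simp: proj_def\<close>)

lemma conj_proj:
  assumes K: "K \<in> carrier_mat m n" and v: "v \<in> carrier_vec n"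
  shows "K * proj v * mat_adjoint K = proj (K *\<^sub>v v)"
proof (rule eq_matI)
  have c: "K * proj v \<in> carrier_mat m n" using assms by auto
  fix i j assume "i < dim_row (proj (K *\<^sub>v v))" "j < dim_col (proj (K *\<^sub>v v))"
  then have ij: "i < m" "j < m" using assms by (auto simp: proj_def)
  have *: "(K * proj v) $$ (i, l) = (K *\<^sub>v v) $ i * cnj (v $ l)" if "l < n" for l
    using that assms ij
    by (subst mult_mat_index_sum[of _ m n _ n], auto simp: mult_mat_vec_index_sum[OF K v] sum_distrib_left mult_ac
         simp del: index_mult_mat_vec)
  have "(K * proj v * mat_adjoint K) $$ (i, j) = (\<Sum>l<n. (K *\<^sub>v v) $ i * cnj (v $ l) * cnj (K $$ (j, l)))"
    using assms ij by (subst mult_mat_index_sum[OF c mat_adjoint_carrier[OF K]]) (auto simp: * simp del: index_mult_mat)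
  also have "\<dots> = (K *\<^sub>v v) $ i * cnj ((K *\<^sub>v v) $ j)"
    using ij by (simp add: mult_mat_vec_index_sum[OF K v] sum_distrib_left mult_ac del: index_mult_mat_vec)
  finally show "(K * proj v * mat_adjoint K) $$ (i, j) = proj (K *\<^sub>v v) $$ (i, j)"
    using assms ij by simp
qed (use assms in \<open>auto simp: proj_def\<close>)

section \<open>Tensor products\<close>

lemma tensor_mat_carrier [simp]:
  "A \<in> carrier_mat a b \<Longrightarrow> B \<in> carrier_mat c d \<Longrightarrow> tensor_mat A B \<in> carrier_mat (a * c) (b * d)"
  by (auto simp: tensor_mat_def)

lemma tensor_mat_dim [simp]:
  "dim_row (tensor_mat A B) = dim_row A * dim_row B"
  "dim_col (tensor_mat A B) = dim_col A * dim_col B"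
  by (auto simp: tensor_mat_def)

lemma tensor_mat_index [simp]:
  "i < dim_row A * dim_row B \<Longrightarrow> j < dim_col A * dim_col B \<Longrightarrow>
   tensor_mat A B $$ (i, j) = A $$ (i div dim_row B, j div dim_col B) * B $$ (i mod dim_row B, j mod dim_col B)"
  by (simp add: tensor_mat_def)

lemma tensor_vec_carrier [simp]:
  "v \<in> carrier_vec a \<Longrightarrow> w \<in> carrier_vec b \<Longrightarrow> tensor_vec v w \<in> carrier_vec (a * b)"
  by (auto simp: tensor_vec_def)

lemma tensor_vec_dim [simp]: "dim_vec (tensor_vec v w) = dim_vec v * dim_vec w"
  by (simp add: tensor_vec_def)

lemma tensor_vec_index [simp]:
  "i < dim_vec v * dim_vec w \<Longrightarrow> tensor_vec v w $ i = v $ (i div dim_vec w) * w $ (i mod dim_vec w)"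
  by (simp add: tensor_vec_def)

lemma tensor_mat_mult:
  assumes A: "A \<in> carrier_mat a b" and C: "C \<in> carrier_mat b c"
    and B: "B \<in> carrier_mat p q" and D: "D \<in> carrier_mat q r"
  shows "tensor_mat A B * tensor_mat C D = tensor_mat (A * C) (B * D)"
proof (rule eq_matI)
  fix i j assume "i < dim_row (tensor_mat (A * C) (B * D))" "j < dim_col (tensor_mat (A * C) (B * D))"
  then have ij: "i < a * p" "j < c * r" using assms by auto
  note i = less_mult_div_mod[OF ij(1)] and j = less_mult_div_mod[OF ij(2)]
  have "(tensor_mat A B * tensor_mat C D) $$ (i, j) = (\<Sum>l<b * q. tensor_mat A B $$ (i, l) * tensor_mat C D $$ (l, j))"
    using ij by (intro mult_mat_index_sum[OF tensor_mat_carrier[OF A B] tensor_mat_carrier[OF C D]])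
  also have "\<dots> = (\<Sum>x<b. \<Sum>y<q. (A $$ (i div p, x) * C $$ (x, j div r)) * (B $$ (i mod p, y) * D $$ (y, j mod r)))"
    using assms ij by (auto simp: sum_lessThan_mult mult_add_less intro!: sum.cong)
  also have "\<dots> = (A * C) $$ (i div p, j div r) * (B * D) $$ (i mod p, j mod r)"
    by (simp add: mult_mat_index_sum[OF A C] mult_mat_index_sum[OF B D] i j sum_product del: index_mult_mat)
  finally show "(tensor_mat A B * tensor_mat C D) $$ (i, j) = tensor_mat (A * C) (B * D) $$ (i, j)"
    using assms ij by simp
qed (use assms in auto)

lemma tensor_mat_mult_vec:
  assumes A: "A \<in> carrier_mat a b" and v: "v \<in> carrier_vec b"
    and B: "B \<in> carrier_mat p q" and w: "w \<in> carrier_vec q"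
  shows "tensor_mat A B *\<^sub>v tensor_vec v w = tensor_vec (A *\<^sub>v v) (B *\<^sub>v w)"
proof (rule eq_vecI)
  fix i assume "i < dim_vec (tensor_vec (A *\<^sub>v v) (B *\<^sub>v w))"
  then have ij: "i < a * p" using assms by auto
  note i = less_mult_div_mod[OF ij(1)]
  have "(tensor_mat A B *\<^sub>v tensor_vec v w) $ i = (\<Sum>l<b * q. tensor_mat A B $$ (i, l) * tensor_vec v w $ l)"
    using ij by (intro mult_mat_vec_index_sum[OF tensor_mat_carrier[OF A B] tensor_vec_carrier[OF v w]])
  also have "\<dots> = (\<Sum>x<b. \<Sum>y<q. (A $$ (i div p, x) * v $ x) * (B $$ (i mod p, y) * w $ y))"
    using assms ij by (auto simp: sum_lessThan_mult mult_add_less intro!: sum.cong)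
  also have "\<dots> = (A *\<^sub>v v) $ (i div p) * (B *\<^sub>v w) $ (i mod p)"
    by (simp add: mult_mat_vec_index_sum[OF A v] mult_mat_vec_index_sum[OF B w] i sum_product del: index_mult_mat_vec)
  finally show "(tensor_mat A B *\<^sub>v tensor_vec v w) $ i = tensor_vec (A *\<^sub>v v) (B *\<^sub>v w) $ i"
    using assms ij by simp
qed (use assms in auto)

text \<open>Mixed-radix digits do not depend on how the radices are grouped. Associativity of the
  tensor product comes down to this.\<close>

lemma div_mod_mult: 
  fixes i p q :: nat
  shows "i div (p * q) = i div q div p" "i mod (p * q) div q = i div q mod p" "i mod (p * q) mod q = i mod q"
proof -
  have eq: "i mod (p * q) = q * (i div q mod p) + i mod q"
    using mod_mult2_eq[of i q p] by (simp add: mult.commute)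
  show "i div (p * q) = i div q div p" by (metis div_mult2_eq mult.commute)
  show "i mod (p * q) div q = i div q mod p" unfolding eq
    by (cases "q = 0") auto
  show "i mod (p * q) mod q = i mod q" unfolding eq by auto
qed

lemma tensor_mat_assoc: "tensor_mat (tensor_mat A B) C = tensor_mat A (tensor_mat B C)"
proof (rule eq_matI)
  fix i j assume *: "i < dim_row (tensor_mat A (tensor_mat B C))" "j < dim_col (tensor_mat A (tensor_mat B C))"
  then have ij: "i < dim_row A * (dim_row B * dim_row C)" "i < dim_row A * dim_row B * dim_row C"
      "j < dim_col A * (dim_col B * dim_col C)" "j < dim_col A * dim_col B * dim_col C"
    by (auto simp: mult.assoc)
  note l = less_mult_div_mod[OF ij(1)] less_mult_div_mod[OF ij(2)]
    less_mult_div_mod[OF ij(3)] less_mult_div_mod[OF ij(4)]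
  show "tensor_mat (tensor_mat A B) C $$ (i, j) = tensor_mat A (tensor_mat B C) $$ (i, j)"
    using ij l by (simp add: div_mod_mult mult.assoc)
qed (auto simp: mult.assoc)

lemma tensor_vec_assoc: "tensor_vec (tensor_vec A B) C = tensor_vec A (tensor_vec B C)"
proof (rule eq_vecI)
  fix i assume *: "i < dim_vec (tensor_vec A (tensor_vec B C))"
  then have ij: "i < dim_vec A * (dim_vec B * dim_vec C)" "i < dim_vec A * dim_vec B * dim_vec C"
    by (auto simp: mult.assoc)
  note l = less_mult_div_mod[OF ij(1)] less_mult_div_mod[OF ij(2)]
  show "tensor_vec (tensor_vec A B) C $ i = tensor_vec A (tensor_vec B C) $ i"
    using ij l by (simp add: div_mod_mult mult.assoc)
qed (auto simp: mult.assoc)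

lemma tensor_mat_one_left [simp]: "tensor_mat (1\<^sub>m (Suc 0)) A = A"
  by (rule eq_matI) auto

lemma tensor_mat_one_right [simp]: "tensor_mat A (1\<^sub>m (Suc 0)) = A"
  by (rule eq_matI) auto

lemma tensor_mat_one_one: "tensor_mat (1\<^sub>m a) (1\<^sub>m b) = 1\<^sub>m (a * b)"
proof (rule eq_matI)
  fix i j assume "i < dim_row (1\<^sub>m (a * b) :: complex mat)" "j < dim_col (1\<^sub>m (a * b) :: complex mat)"
  then have ij: "i < a * b" "j < a * b" by auto
  note l = less_mult_div_mod[OF ij(1)] less_mult_div_mod[OF ij(2)]
  have "i = j \<longleftrightarrow> i div b = j div b \<and> i mod b = j mod b" by (metis div_mult_mod_eq)
  then show "tensor_mat (1\<^sub>m a) (1\<^sub>m b) $$ (i, j) = 1\<^sub>m (a * b) $$ (i, j)"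
    using ij l by simp
qed auto

lemma tensor_mat_smult_left: "tensor_mat (c \<cdot>\<^sub>m A) B = c \<cdot>\<^sub>m tensor_mat A B"
  by (rule eq_matI) (auto simp: less_mult_div_mod)

lemma tensor_mat_smult_right: "tensor_mat A (c \<cdot>\<^sub>m B) = c \<cdot>\<^sub>m tensor_mat A B"
  by (rule eq_matI) (auto simp: less_mult_div_mod)

lemma tensor_mat_adjoint: "mat_adjoint (tensor_mat A B) = tensor_mat (mat_adjoint A) (mat_adjoint B)"
  by (rule eq_matI) (auto simp: less_mult_div_mod)

section \<open>Pauli operators\<close>

lemma mat_2_eqI:
  assumes "A \<in> carrier_mat 2 2" "B \<in> carrier_mat 2 2"
    and "A $$ (0, 0) = B $$ (0, 0)" "A $$ (0, 1) = B $$ (0, 1)"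
    and "A $$ (1, 0) = B $$ (1, 0)" "A $$ (1, 1) = B $$ (1, 1)"
  shows "A = B"
proof (rule eq_matI)
  fix i j assume "i < dim_row B" "j < dim_col B"
  then have "i = 0 \<or> i = 1" "j = 0 \<or> j = 1" using assms by auto
  then show "A $$ (i, j) = B $$ (i, j)" using assms by auto
qed (use assms in auto)

lemma mult_mat_2_carrier: "A \<in> carrier_mat 2 2 \<Longrightarrow> B \<in> carrier_mat 2 2 \<Longrightarrow> A * B \<in> carrier_mat 2 2"
  by simp

lemma mult_mat_2_index:
  assumes "A \<in> carrier_mat 2 2" "B \<in> carrier_mat 2 2" "i < 2" "j < 2"
  shows "(A * B) $$ (i, j) = A $$ (i, 0) * B $$ (0, j) + A $$ (i, 1) * B $$ (1, j)"
  by (subst mult_mat_index_sum[OF assms]) (simp add: sum_lessThan_2)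

lemma smult_smult_mat [simp]: "a \<cdot>\<^sub>m (b \<cdot>\<^sub>m (A :: complex mat)) = (a * b) \<cdot>\<^sub>m A"
  by (rule eq_matI) auto

lemma one_smult_mat [simp]: "1 \<cdot>\<^sub>m (A :: complex mat) = A"
  by (rule eq_matI) auto

lemma smult_mat_mult_vec:
  fixes A :: "complex mat"
  assumes "A \<in> carrier_mat n m" "v \<in> carrier_vec m"
  shows "(c \<cdot>\<^sub>m A) *\<^sub>v v = c \<cdot>\<^sub>v (A *\<^sub>v v)"
  using assms by (intro eq_vecI) auto

definition qubit_paulis :: "complex mat set" where
  "qubit_paulis = {1\<^sub>m 2, pauli_X, pauli_Y, pauli_Z}"

lemma pauli_index [simp]:
  "pauli_X $$ (0, 0) = 0" "pauli_X $$ (0, Suc 0) = 1" "pauli_X $$ (Suc 0, 0) = 1" "pauli_X $$ (Suc 0, Suc 0) = 0"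
  "pauli_Y $$ (0, 0) = 0" "pauli_Y $$ (0, Suc 0) = - \<i>" "pauli_Y $$ (Suc 0, 0) = \<i>" "pauli_Y $$ (Suc 0, Suc 0) = 0"
  "pauli_Z $$ (0, 0) = 1" "pauli_Z $$ (0, Suc 0) = 0" "pauli_Z $$ (Suc 0, 0) = 0" "pauli_Z $$ (Suc 0, Suc 0) = -1"
  by (auto simp: pauli_X_def pauli_Y_def pauli_Z_def mat_of_rows_list_def)

lemma pauli_carrier [simp]:
  "pauli_X \<in> carrier_mat 2 2" "pauli_Y \<in> carrier_mat 2 2" "pauli_Z \<in> carrier_mat 2 2"
  by (auto simp: pauli_X_def pauli_Y_def pauli_Z_def mat_of_rows_list_def)

lemma pauli_dim [simp]:
  "dim_row pauli_X = 2" "dim_row pauli_Y = 2" "dim_row pauli_Z = 2"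
  "dim_col pauli_X = 2" "dim_col pauli_Y = 2" "dim_col pauli_Z = 2"
  by (auto simp: pauli_X_def pauli_Y_def pauli_Z_def mat_of_rows_list_def)

lemma qubit_paulis_carrier: "P \<in> qubit_paulis \<Longrightarrow> P \<in> carrier_mat 2 2"
  by (auto simp: qubit_paulis_def)

lemma qubit_paulis_adjoint: "P \<in> qubit_paulis \<Longrightarrow> mat_adjoint P = P"
  by (rule mat_2_eqI) (auto simp: qubit_paulis_def)

lemma qubit_paulis_square: "P \<in> qubit_paulis \<Longrightarrow> P * P = 1\<^sub>m 2"
proof (rule mat_2_eqI)
  assume P: "P \<in> qubit_paulis"
  note c = qubit_paulis_carrier[OF P]
  show "P * P \<in> carrier_mat 2 2" using c by auto
qed (auto simp: mult_mat_2_index qubit_paulis_carrier simp del: index_mult_mat, auto simp: qubit_paulis_def)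

text \<open>Two single-qubit Pauli matrices commute or anticommute, and each squares to one. The
  sixteen pairs are checked entrywise, trying the sign 1 before the sign -1.\<close>

lemma qubit_paulis_conj:
  assumes P: "P \<in> qubit_paulis" and Q: "Q \<in> qubit_paulis"
  shows "\<exists>s\<in>{1, -1}. P * Q * P = s \<cdot>\<^sub>m Q"
proof -
  note c = qubit_paulis_carrier[OF P] qubit_paulis_carrier[OF Q]
  have cc: "P * Q * P \<in> carrier_mat 2 2" "P * Q \<in> carrier_mat 2 2" "\<And>s. s \<cdot>\<^sub>m Q \<in> carrier_mat 2 2" using c by auto
  note ix = mult_mat_2_index[OF cc(2) c(1)] mult_mat_2_index[OF c]
  have "P * Q * P = 1 \<cdot>\<^sub>m Q \<or> P * Q * P = (-1) \<cdot>\<^sub>m Q"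
    using P Q unfolding qubit_paulis_def
    apply (elim insertE emptyE)
                   apply (simp_all only:)
    apply (((rule disjI1, rule mat_2_eqI; (simp add: mult_mat_2_index mult_mat_2_carrier del: index_mult_mat; fail)) | 
       (rule disjI2, rule mat_2_eqI; (simp add: mult_mat_2_index mult_mat_2_carrier del: index_mult_mat; fail)))+)
    done
  then show ?thesis by blast
qed

definition pauli_string :: "complex mat list \<Rightarrow> complex mat" where
  "pauli_string ps = foldr tensor_mat ps (1\<^sub>m 1)"

lemma pauli_string_simps [simp]:
  "pauli_string [] = 1\<^sub>m (Suc 0)"
  "pauli_string (p # ps) = tensor_mat p (pauli_string ps)"
  by (simp_all add: pauli_string_def)

lemma paulis_alt:
  "paulis n = {s \<cdot>\<^sub>m pauli_string ps | s ps. s \<in> {1, - 1} \<and> length ps = n \<and> set ps \<subseteq> qubit_paulis}"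
  unfolding paulis_def qubit_paulis_def pauli_string_def ..

lemma pauli_string_carrier:
  "set ps \<subseteq> qubit_paulis \<Longrightarrow> pauli_string ps \<in> carrier_mat (2 ^ length ps) (2 ^ length ps)"
  by (induction ps) (auto simp: qubit_paulis_carrier)

lemma mat_adjoint_one [simp]: "mat_adjoint (1\<^sub>m n :: complex mat) = 1\<^sub>m n"
  by (rule eq_matI) auto

lemma pauli_string_adjoint:
  "set ps \<subseteq> qubit_paulis \<Longrightarrow> mat_adjoint (pauli_string ps) = pauli_string ps"
  by (induction ps) (auto simp: tensor_mat_adjoint qubit_paulis_adjoint)

lemma pauli_string_square:
  "set ps \<subseteq> qubit_paulis \<Longrightarrow> pauli_string ps * pauli_string ps = 1\<^sub>m (2 ^ length ps)"
proof (induction ps)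
  case (Cons p ps)
  then have p: "p \<in> qubit_paulis" and ps: "set ps \<subseteq> qubit_paulis" by auto
  note c = qubit_paulis_carrier[OF p] pauli_string_carrier[OF ps]
  show ?case
    using Cons.IH[OF ps] qubit_paulis_square[OF p] 
    by (simp add: tensor_mat_mult[OF c(1) c(1) c(2) c(2)] tensor_mat_one_one)
qed auto

lemma pauli_string_conj:
  "length ps = length qs \<Longrightarrow> set ps \<subseteq> qubit_paulis \<Longrightarrow> set qs \<subseteq> qubit_paulis \<Longrightarrow>
   \<exists>s\<in>{1, -1}. pauli_string ps * pauli_string qs * pauli_string ps = s \<cdot>\<^sub>m pauli_string qs"
proof (induction ps qs rule: list_induct2)
  case Nil
  show ?case by (intro bexI[of _ 1]) auto
next
  case (Cons p ps q qs)
  then have p: "p \<in> qubit_paulis" and ps: "set ps \<subseteq> qubit_paulis" 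
    and q: "q \<in> qubit_paulis" and qs: "set qs \<subseteq> qubit_paulis" by auto
  note c = qubit_paulis_carrier[OF p] pauli_string_carrier[OF ps]
    qubit_paulis_carrier[OF q] pauli_string_carrier[OF qs, folded Cons.hyps]
  obtain s where s: "s \<in> {1, -1}" "p * q * p = s \<cdot>\<^sub>m q" using qubit_paulis_conj[OF p q] by blast
  obtain t where t: "t \<in> {1, -1}" "pauli_string ps * pauli_string qs * pauli_string ps = t \<cdot>\<^sub>m pauli_string qs"
    using Cons.IH[OF ps qs] by blast
  have "tensor_mat p (pauli_string ps) * tensor_mat q (pauli_string qs) * tensor_mat p (pauli_string ps) = 
     tensor_mat (p * q * p) (pauli_string ps * pauli_string qs * pauli_string ps)"
    by (subst tensor_mat_mult[OF c(1,3,2,4)], rule tensor_mat_mult) (use c in auto)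
  also have "\<dots> = (s * t) \<cdot>\<^sub>m tensor_mat q (pauli_string qs)"
    by (simp add: s t tensor_mat_smult_left tensor_mat_smult_right mult.commute)
  finally show ?case using s(1) t(1) by (intro bexI[of _ "s * t"]) auto
qed

lemma pauli_string_append: "pauli_string (ps @ qs) = tensor_mat (pauli_string ps) (pauli_string qs)"
  by (induction ps) (auto simp: tensor_mat_assoc)

lemma paulisE:
  assumes "P \<in> paulis n"
  obtains s ps where "s \<in> {1, -1}" "length ps = n" "set ps \<subseteq> qubit_paulis" "P = s \<cdot>\<^sub>m pauli_string ps"
  using assms unfolding paulis_alt by blast

lemma paulis_carrier: "P \<in> paulis n \<Longrightarrow> P \<in> carrier_mat (2 ^ n) (2 ^ n)"
  by (elim paulisE) (use pauli_string_carrier in auto)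

lemma mat_adjoint_smult: "mat_adjoint (c \<cdot>\<^sub>m A) = cnj c \<cdot>\<^sub>m mat_adjoint A"
  by (rule eq_matI) auto

lemma mat_adjoint_add:
  fixes A B :: "complex mat"
  shows "A \<in> carrier_mat n m \<Longrightarrow> B \<in> carrier_mat n m \<Longrightarrow> mat_adjoint (A + B) = mat_adjoint A + mat_adjoint B"
  by (rule eq_matI) auto

lemma paulis_adjoint: "P \<in> paulis n \<Longrightarrow> mat_adjoint P = P"
  by (elim paulisE) (auto simp: mat_adjoint_smult pauli_string_adjoint)

lemma paulis_square: "P \<in> paulis n \<Longrightarrow> P * P = 1\<^sub>m (2 ^ n)"
proof (elim paulisE)
  fix s ps assume *: "s \<in> {1, -1::complex}" "length ps = n" "set ps \<subseteq> qubit_paulis" "P = s \<cdot>\<^sub>m pauli_string ps"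
  note c = pauli_string_carrier[OF *(3)]
  have "P * P = (s * s) \<cdot>\<^sub>m (pauli_string ps * pauli_string ps)"
    unfolding * using c by (simp add: mult_smult_distrib[of _ "2^length ps" "2^length ps"] mult_smult_assoc_mat[of _ "2^length ps" "2^length ps"])
  then show ?thesis using * by (auto simp: pauli_string_square)
qed

lemma paulis_tensor: "P \<in> paulis n \<Longrightarrow> Q \<in> paulis m \<Longrightarrow> tensor_mat P Q \<in> paulis (n + m)"
proof (elim paulisE)
  fix s t ps qs 
  assume *: "s \<in> {1, -1::complex}" "length ps = n" "set ps \<subseteq> qubit_paulis" "P = s \<cdot>\<^sub>m pauli_string ps"
    "t \<in> {1, -1::complex}" "length qs = m" "set qs \<subseteq> qubit_paulis" "Q = t \<cdot>\<^sub>m pauli_string qs"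
  then have "tensor_mat P Q = (s * t) \<cdot>\<^sub>m pauli_string (ps @ qs)"
    unfolding pauli_string_append by (simp add: tensor_mat_smult_left tensor_mat_smult_right mult.commute)
  moreover have "s * t \<in> {1, -1}" "length (ps @ qs) = n + m" "set (ps @ qs) \<subseteq> qubit_paulis" using * by auto
  ultimately show ?thesis unfolding paulis_alt by blast
qed

lemma qubit_paulis_subset: "P \<in> qubit_paulis \<Longrightarrow> P \<in> paulis 1"
  unfolding paulis_alt by (intro CollectI exI[of _ 1] exI[of _ "[P]"]) auto

lemma one_in_paulis: "1\<^sub>m (2 ^ n) \<in> paulis n"
proof (induction n)
  case 0
  show ?case unfolding paulis_alt by (intro CollectI exI[of _ 1] exI[of _ "[]"]) auto
next
  case (Suc n)
  have "1\<^sub>m 2 \<in> paulis 1" by (rule qubit_paulis_subset) (simp add: qubit_paulis_def)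
  from paulis_tensor[OF this Suc] show ?case by (simp add: tensor_mat_one_one)
qed

text \<open>Conjugating one Pauli operator by another changes at most its sign. This makes the
  correction by \<open>YY\<close> in \<open>decode\<close> a legal Clifford step.\<close>

lemma paulis_subset_clifford_group: "paulis n \<subseteq> clifford_group n"
proof
  fix P assume P: "P \<in> paulis n"
  have "P * Q * P \<in> paulis n" if "Q \<in> paulis n" for Q
    using that P
  proof (elim paulisE)
    fix s t ps qs 
    assume *: "s \<in> {1, -1::complex}" "length ps = n" "set ps \<subseteq> qubit_paulis" "P = s \<cdot>\<^sub>m pauli_string ps"
      "t \<in> {1, -1::complex}" "length qs = n" "set qs \<subseteq> qubit_paulis" "Q = t \<cdot>\<^sub>m pauli_string qs"
    have c: "pauli_string ps \<in> carrier_mat (2^n) (2^n)" "pauli_string qs \<in> carrier_mat (2^n) (2^n)"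
      using pauli_string_carrier[OF *(3)] pauli_string_carrier[OF *(7)] * by auto
    have len: "length ps = length qs" using *(2,6) by simp
    obtain r where r: "r \<in> {1, -1}" "pauli_string ps * pauli_string qs * pauli_string ps = r \<cdot>\<^sub>m pauli_string qs"
      using pauli_string_conj[OF len *(3,7)] by (elim bexE)
    have "P * Q * P = (s * s * t) \<cdot>\<^sub>m (pauli_string ps * pauli_string qs * pauli_string ps)"
      unfolding * using c by (simp add: mult_smult_distrib[of _ "2^n" "2^n" _ "2^n"] mult_smult_assoc_mat[of _ "2^n" "2^n" _ "2^n"] mult_ac)
    also have "\<dots> = (s * s * t * r) \<cdot>\<^sub>m pauli_string qs" by (simp add: r)
    moreover have "s * s * t * r \<in> {1, -1}" using * r by auto
    ultimately show ?thesis unfolding paulis_alt using * by auto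
  qed
  then show "P \<in> clifford_group n"
    using P by (auto simp: clifford_group_def unitary_mat_def paulis_carrier paulis_adjoint paulis_square)
qed

lemma pauli_projector_carrier: "P \<in> paulis n \<Longrightarrow> pauli_projector n P s \<in> carrier_mat (2 ^ n) (2 ^ n)"
  using paulis_carrier by (auto simp: pauli_projector_def)

lemma pauli_projector_adjoint:
  "P \<in> paulis n \<Longrightarrow> s \<in> {1, -1} \<Longrightarrow> mat_adjoint (pauli_projector n P s) = pauli_projector n P s"
  by (auto simp: pauli_projector_def mat_adjoint_smult mat_adjoint_add[of _ "2^n" "2^n"] paulis_adjoint paulis_carrier)

lemma pauli_projector_idem:
  assumes P: "P \<in> paulis n" and s: "s \<in> {1, -1}"
  shows "pauli_projector n P s * pauli_projector n P s = pauli_projector n P s"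
proof -
  let ?I = "1\<^sub>m (2^n) :: complex mat"
  note c = paulis_carrier[OF P]
  have sP: "s \<cdot>\<^sub>m P * (s \<cdot>\<^sub>m P) = ?I"
    using c s paulis_square[OF P]
    by (auto simp: mult_smult_distrib[of _ "2^n" "2^n" _ "2^n"] mult_smult_assoc_mat[of _ "2^n" "2^n" _ "2^n"])
  have "(?I + s \<cdot>\<^sub>m P) * (?I + s \<cdot>\<^sub>m P) = (?I * ?I + s \<cdot>\<^sub>m P * ?I) + (?I * (s \<cdot>\<^sub>m P) + s \<cdot>\<^sub>m P * (s \<cdot>\<^sub>m P))"
    using c by (simp add: mult_add_distrib_mat[of _ "2^n" "2^n" _ "2^n"] add_mult_distrib_mat[of _ "2^n" "2^n" _ _ "2^n"])
  also have "\<dots> = 2 \<cdot>\<^sub>m (?I + s \<cdot>\<^sub>m P)"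
    unfolding sP using c by (intro eq_matI) auto
  finally show ?thesis
    unfolding pauli_projector_def using c
    by (simp add: mult_smult_distrib[of _ "2^n" "2^n" _ "2^n"] mult_smult_assoc_mat[of _ "2^n" "2^n" _ "2^n"])
qed

lemma pauli_projector_add:
  assumes P: "P \<in> paulis n"
  shows "pauli_projector n P 1 + pauli_projector n P (- 1) = 1\<^sub>m (2 ^ n)"
  using paulis_carrier[OF P] by (intro eq_matI) (auto simp: pauli_projector_def field_simps)

lemma pauli_projector_mult_eigenvector:
  assumes P: "P \<in> paulis n" and v: "v \<in> carrier_vec (2 ^ n)" and "P *\<^sub>v v = t \<cdot>\<^sub>v v"
  shows "pauli_projector n P s *\<^sub>v v = ((1 + s * t) / 2) \<cdot>\<^sub>v v"
proof -
  note c = paulis_carrier[OF P]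
  have "pauli_projector n P s *\<^sub>v v = (1 / 2) \<cdot>\<^sub>v (v + s \<cdot>\<^sub>v (t \<cdot>\<^sub>v v))"
    unfolding pauli_projector_def using c v assms(3) 
    by (simp add: smult_mat_mult_vec[of _ "2^n" "2^n"] add_mult_distrib_mat_vec[of _ "2^n" "2^n"])
  also have "\<dots> = ((1 + s * t) / 2) \<cdot>\<^sub>v v" by (rule eq_vecI) (auto simp: field_simps)
  finally show ?thesis .
qed

section \<open>Matrices over the Gaussian rationals\<close>

text \<open>The field Q(i); the imaginary unit is needed because of \<open>pauli_Y\<close>. Closure
  under division is stated for numerals only, as all denominators that occur are fixed numbers such
  as the 2 in a Pauli projector.\<close>

definition gaussian_rats :: "complex set" where
  "gaussian_rats = {z. Re z \<in> \<rat> \<and> Im z \<in> \<rat>}"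

lemma gaussian_rats_intros [simp, intro]:
  "0 \<in> gaussian_rats" "1 \<in> gaussian_rats" "\<i> \<in> gaussian_rats" "numeral k \<in> gaussian_rats"
  "x \<in> gaussian_rats \<Longrightarrow> y \<in> gaussian_rats \<Longrightarrow> x + y \<in> gaussian_rats"
  "x \<in> gaussian_rats \<Longrightarrow> y \<in> gaussian_rats \<Longrightarrow> x - y \<in> gaussian_rats"
  "x \<in> gaussian_rats \<Longrightarrow> y \<in> gaussian_rats \<Longrightarrow> x * y \<in> gaussian_rats"
  "x \<in> gaussian_rats \<Longrightarrow> x / numeral k \<in> gaussian_rats"
  "x \<in> gaussian_rats \<Longrightarrow> - x \<in> gaussian_rats"
  "x \<in> gaussian_rats \<Longrightarrow> cnj x \<in> gaussian_rats"
  by (auto simp: gaussian_rats_def)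

lemma gaussian_rats_sum: "(\<And>i. i \<in> A \<Longrightarrow> f i \<in> gaussian_rats) \<Longrightarrow> sum f A \<in> gaussian_rats"
  by (induction A rule: infinite_finite_induct) auto

definition gaussian_mat :: "complex mat \<Rightarrow> bool" where
  "gaussian_mat A \<longleftrightarrow> (\<forall>i<dim_row A. \<forall>j<dim_col A. A $$ (i, j) \<in> gaussian_rats)"

lemma gaussian_matD: "gaussian_mat A \<Longrightarrow> i < dim_row A \<Longrightarrow> j < dim_col A \<Longrightarrow> A $$ (i, j) \<in> gaussian_rats"
  by (auto simp: gaussian_mat_def)

lemma gaussian_mat_add:
  "A \<in> carrier_mat n m \<Longrightarrow> B \<in> carrier_mat n m \<Longrightarrow> gaussian_mat A \<Longrightarrow> gaussian_mat B \<Longrightarrow> gaussian_mat (A + B)"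
  by (auto simp: gaussian_mat_def)

lemma gaussian_mat_smult: "c \<in> gaussian_rats \<Longrightarrow> gaussian_mat A \<Longrightarrow> gaussian_mat (c \<cdot>\<^sub>m A)"
  by (auto simp: gaussian_mat_def)

lemma gaussian_mat_one: "gaussian_mat (1\<^sub>m n)"
  by (auto simp: gaussian_mat_def)

lemma gaussian_mat_mult:
  assumes A: "A \<in> carrier_mat n m" and B: "B \<in> carrier_mat m k" and "gaussian_mat A" "gaussian_mat B"
  shows "gaussian_mat (A * B)"
  unfolding gaussian_mat_def
proof (intro allI impI)
  fix i j assume "i < dim_row (A * B)" "j < dim_col (A * B)"
  then have ij: "i < n" "j < k" using A B by auto
  show "(A * B) $$ (i, j) \<in> gaussian_rats"
    unfolding mult_mat_index_sum[OF A B ij] 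
    using assms ij by (intro gaussian_rats_sum gaussian_rats_intros(7) gaussian_matD) auto
qed

lemma gaussian_mat_tensor: "gaussian_mat A \<Longrightarrow> gaussian_mat B \<Longrightarrow> gaussian_mat (tensor_mat A B)"
  unfolding gaussian_mat_def by (auto simp: less_mult_div_mod)

lemma gaussian_mat_partial_trace:
  assumes "A \<in> carrier_mat (2 ^ (n + k)) (2 ^ (n + k))" "gaussian_mat A"
  shows "gaussian_mat (partial_trace n k A)"
  using assms unfolding gaussian_mat_def partial_trace_def 
  by (auto intro!: gaussian_rats_sum simp: mult_add_less power_add)

lemma gaussian_mat_qubit_paulis: "P \<in> qubit_paulis \<Longrightarrow> gaussian_mat P"
  by (auto simp: qubit_paulis_def gaussian_mat_one, auto simp: gaussian_mat_def less_2_cases_iff)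

lemma gaussian_mat_paulis: "P \<in> paulis n \<Longrightarrow> gaussian_mat P"
proof (elim paulisE)
  fix s ps assume *: "s \<in> {1, -1::complex}" "length ps = n" "set ps \<subseteq> qubit_paulis" "P = s \<cdot>\<^sub>m pauli_string ps"
  have "gaussian_mat (pauli_string ps)" using *(3)
    by (induction ps) (auto intro: gaussian_mat_tensor gaussian_mat_one gaussian_mat_qubit_paulis)
  then show ?thesis using * by (auto intro!: gaussian_mat_smult)
qed

lemma gaussian_mat_pauli_projector:
  "P \<in> paulis n \<Longrightarrow> s \<in> {1, -1} \<Longrightarrow> gaussian_mat (pauli_projector n P s)"
  unfolding pauli_projector_def
  by (intro gaussian_mat_smult gaussian_mat_add[of _ "2^n" "2^n"])
    (auto intro: gaussian_mat_one gaussian_mat_paulis simp: paulis_carrier)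

text \<open>Generated inductively instead of written as sums over all Pauli strings, so that a claim
  about a linear map follows by rule induction from its values on Pauli operators.\<close>

inductive_set pauli_span :: "nat \<Rightarrow> complex mat set" for n where
  smult_pauli: "P \<in> paulis n \<Longrightarrow> c \<in> gaussian_rats \<Longrightarrow> c \<cdot>\<^sub>m P \<in> pauli_span n"
| add: "A \<in> pauli_span n \<Longrightarrow> B \<in> pauli_span n \<Longrightarrow> A + B \<in> pauli_span n"

lemma pauli_span_carrier: "A \<in> pauli_span n \<Longrightarrow> A \<in> carrier_mat (2 ^ n) (2 ^ n)"
  by (induction rule: pauli_span.induct) (auto simp: paulis_carrier)

lemma tensor_mat_add_right:
  assumes "A \<in> carrier_mat n m" "B \<in> carrier_mat n m"
  shows "tensor_mat P (A + B) = tensor_mat P A + tensor_mat P B"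
  using assms by (intro eq_matI) (auto simp: less_mult_div_mod algebra_simps)

lemma tensor_mat_add_left:
  assumes "A \<in> carrier_mat n m" "B \<in> carrier_mat n m"
  shows "tensor_mat (A + B) P = tensor_mat A P + tensor_mat B P"
  using assms by (intro eq_matI) (auto simp: less_mult_div_mod algebra_simps)

lemma pauli_span_tensor:
  assumes P: "P \<in> qubit_paulis" and A: "A \<in> pauli_span n"
  shows "tensor_mat P A \<in> pauli_span (Suc n)"
  using A
proof induction
  case (smult_pauli Q c)
  have "tensor_mat P Q \<in> paulis (Suc n)"
    using paulis_tensor[OF qubit_paulis_subset[OF P] smult_pauli(1)] by simp
  then show ?case using smult_pauli(2) unfolding tensor_mat_smult_right by (rule pauli_span.smult_pauli)
next
  case (add A B)
  then show ?case 
    by (subst tensor_mat_add_right[of _ "2^n" "2^n"]) (auto intro: pauli_span.add simp: pauli_span_carrier)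
qed

text \<open>The blocks of a matrix are recovered from half-sums and half-differences of the blocks,
  which are the coefficients in front of the four Pauli matrices of the first qubit.\<close>

lemma gaussian_mat_in_pauli_span:
  "A \<in> carrier_mat (2 ^ n) (2 ^ n) \<Longrightarrow> gaussian_mat A \<Longrightarrow> A \<in> pauli_span n"
proof (induction n arbitrary: A)
  case 0
  have "A = (A $$ (0, 0)) \<cdot>\<^sub>m 1\<^sub>m 1" using 0 by (intro eq_matI) auto
  moreover have "A $$ (0, 0) \<in> gaussian_rats" using 0 by (intro gaussian_matD) auto
  ultimately show ?case using one_in_paulis[of 0] by (metis pauli_span.smult_pauli power_0)
next
  case (Suc n)
  let ?N = "2 ^ n :: nat"
  define B where "B f = mat ?N ?N (\<lambda>(i, j). f (A $$ (i, j)) (A $$ (i, j + ?N)) (A $$ (i + ?N, j)) (A $$ (i + ?N, j + ?N)) / (2::complex))"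
    for f
  have B [simp]: "B f \<in> carrier_mat ?N ?N" for f by (simp add: B_def)
  have Bd [simp]: "dim_row (B f) = ?N" "dim_col (B f) = ?N" for f by (simp_all add: B_def)
  \<comment> \<open>Up to the factor 1/2 in \<open>B\<close>, the coefficient of a Pauli matrix P in
    the block matrix M with rows (a, b) and (c, d) is the trace of P M; for \<open>pauli_Y\<close>
    this gives i (b - c).\<close>
  let ?I = "\<lambda>a b c d. a + d" and ?Z = "\<lambda>a b c d. a - d" and ?X = "\<lambda>a b c d. b + c" and ?Y = "\<lambda>a b c d. \<i> * (b - c)"
  have mem: "A $$ (i, j) \<in> gaussian_rats" if "i < 2 * ?N" "j < 2 * ?N" for i j
    using that Suc.prems by (intro gaussian_matD) auto
  have "gaussian_mat (B ?I)" "gaussian_mat (B ?Z)" "gaussian_mat (B ?X)" "gaussian_mat (B ?Y)"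
    by (auto simp: gaussian_mat_def B_def intro!: mem gaussian_rats_intros(5-8))
  then have *: "B ?I \<in> pauli_span n" "B ?Z \<in> pauli_span n" "B ?X \<in> pauli_span n" "B ?Y \<in> pauli_span n"
    by (auto intro: Suc.IH)
  have "A = tensor_mat (1\<^sub>m 2) (B ?I) + tensor_mat pauli_Z (B ?Z) + tensor_mat pauli_X (B ?X) + tensor_mat pauli_Y (B ?Y)"
    (is "A = ?R")
  proof (rule eq_matI)
    fix i j assume "i < dim_row ?R" "j < dim_col ?R"
    then have ij: "i < 2 * ?N" "j < 2 * ?N" by auto
    \<comment> \<open>The quotient is the bit of the first qubit and the remainder is the position
      inside the block.\<close>
    have i: "i < ?N \<and> i div ?N = 0 \<and> i mod ?N = i \<or> i div ?N = 1 \<and> i mod ?N + ?N = i"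
      using ij(1) by (cases "i < ?N") (auto simp: not_less le_div_geq le_mod_geq)
    have j: "j < ?N \<and> j div ?N = 0 \<and> j mod ?N = j \<or> j div ?N = 1 \<and> j mod ?N + ?N = j"
      using ij(2) by (cases "j < ?N") (auto simp: not_less le_div_geq le_mod_geq)
    have R: "?R $$ (i, j) = 1\<^sub>m 2 $$ (i div ?N, j div ?N) * B ?I $$ (i mod ?N, j mod ?N)
       + pauli_Z $$ (i div ?N, j div ?N) * B ?Z $$ (i mod ?N, j mod ?N)
       + pauli_X $$ (i div ?N, j div ?N) * B ?X $$ (i mod ?N, j mod ?N)
       + pauli_Y $$ (i div ?N, j div ?N) * B ?Y $$ (i mod ?N, j mod ?N)"
      using ij by simp
    have B_ix: "B f $$ (i mod ?N, j mod ?N) = f (A $$ (i mod ?N, j mod ?N)) (A $$ (i mod ?N, j mod ?N + ?N)) 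
       (A $$ (i mod ?N + ?N, j mod ?N)) (A $$ (i mod ?N + ?N, j mod ?N + ?N)) / 2" for f
      by (simp add: B_def)
    show "A $$ (i, j) = ?R $$ (i, j)"
      unfolding R B_ix using i j by (elim disjE) (auto simp: field_simps)
  qed (use Suc.prems in auto)
  then show ?case
    using * by (auto intro!: pauli_span.add pauli_span_tensor simp: qubit_paulis_def)
qed

lemma clifford_group_carrier: "C \<in> clifford_group n \<Longrightarrow> C \<in> carrier_mat (2 ^ n) (2 ^ n)"
  by (auto simp: clifford_group_def unitary_mat_def)

text \<open>The entries of \<open>C\<close> may lie outside Q(i), as for the Hadamard gate, so
  multiplying Gaussian matrices does not help. Instead \<open>A\<close> is expanded in Pauli
  operators: conjugation is linear and sends each of them to a Pauli operator, which is
  Gaussian.\<close>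

lemma gaussian_mat_clifford_conj:
  assumes C: "C \<in> clifford_group n" and A: "A \<in> carrier_mat (2 ^ n) (2 ^ n)" "gaussian_mat A"
  shows "gaussian_mat (C * A * mat_adjoint C)"
  using gaussian_mat_in_pauli_span[OF A]
proof induction
  let ?N = "2 ^ n :: nat"
  have c [simp]: "C \<in> carrier_mat ?N ?N" "mat_adjoint C \<in> carrier_mat ?N ?N" using clifford_group_carrier[OF C] by auto
  {
    case (smult_pauli P c)
    have "C * (c \<cdot>\<^sub>m P) * mat_adjoint C = c \<cdot>\<^sub>m (C * P * mat_adjoint C)"
      using paulis_carrier[OF smult_pauli(1)] mult_carrier_mat[OF c(1) paulis_carrier[OF smult_pauli(1)]]
      by (simp add: mult_smult_distrib[of _ ?N ?N _ ?N] mult_smult_assoc_mat[of _ ?N ?N _ ?N])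
    moreover have "C * P * mat_adjoint C \<in> paulis n" using C smult_pauli(1) by (auto simp: clifford_group_def)
    ultimately show ?case using smult_pauli(2) by (auto intro: gaussian_mat_smult gaussian_mat_paulis)
  next
    case (add A B)
    note AB = add(1,2)[THEN pauli_span_carrier]
    have "C * (A + B) * mat_adjoint C = C * A * mat_adjoint C + C * B * mat_adjoint C"
      using AB AB[THEN mult_carrier_mat[OF c(1)]]
      by (simp add: mult_add_distrib_mat[of _ ?N ?N _ ?N] add_mult_distrib_mat[of _ ?N ?N _ _ ?N])
    moreover have "C * A * mat_adjoint C \<in> carrier_mat ?N ?N" "C * B * mat_adjoint C \<in> carrier_mat ?N ?N"
      using AB by (meson c mult_carrier_mat)+
    ultimately show ?case using add by (simp add: gaussian_mat_add[of _ ?N ?N])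
  }
qed

text \<open>The product of the projectors of the generators is the rank-one projector of the state.\<close>

lemma gaussian_mat_proj_pure_stabilizer:
  assumes "pure_stabilizer n v"
  shows "gaussian_mat (proj v)"
proof -
  let ?N = "2 ^ n :: nat"
  from assms obtain gs where v: "v \<in> carrier_vec ?N" "normalized v" and gs: "set gs \<subseteq> paulis n"
    and comm: "\<And>g h. g \<in> set gs \<Longrightarrow> h \<in> set gs \<Longrightarrow> g * h = h * g"
    and stab: "\<And>g. g \<in> set gs \<Longrightarrow> g *\<^sub>v v = v"
    and uniq: "\<And>w. w \<in> carrier_vec ?N \<Longrightarrow> normalized w \<Longrightarrow> (\<forall>g \<in> set gs. g *\<^sub>v w = w) \<Longrightarrow> \<exists>c. cmod c = 1 \<and> w = c \<cdot>\<^sub>v v"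
    unfolding pure_stabilizer_def by blast
  define Q where "Q hs = foldr (\<lambda>g M. pauli_projector n g 1 * M) hs (1\<^sub>m ?N)" for hs
  have Q_simps [simp]: "Q [] = 1\<^sub>m ?N" "Q (g # hs) = pauli_projector n g 1 * Q hs" for g hs
    by (simp_all add: Q_def)
  have pc: "pauli_projector n g 1 \<in> carrier_mat ?N ?N" if "g \<in> set gs" for g
    using that gs by (auto intro: pauli_projector_carrier)
  have gc: "g \<in> carrier_mat ?N ?N" if "g \<in> set gs" for g using that gs by (auto intro: paulis_carrier)
  have Qc: "Q hs \<in> carrier_mat ?N ?N" if "set hs \<subseteq> set gs" for hs
    using that by (induction hs) (auto intro!: mult_carrier_mat pc)
  have Qg: "gaussian_mat (Q hs)" if "set hs \<subseteq> set gs" for hs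
    using that
  proof (induction hs)
    case (Cons g hs)
    then show ?case using gs
      by (auto intro!: gaussian_mat_mult[OF pc Qc] gaussian_mat_pauli_projector)
  qed (auto simp: gaussian_mat_one)
  have gp: "g * pauli_projector n h 1 = pauli_projector n h 1 * g" if "g \<in> set gs" "h \<in> set gs" for g h
    using gc[OF that(1)] gc[OF that(2)] comm[OF that] unfolding pauli_projector_def 
    by (simp add: mult_smult_distrib[of _ ?N ?N _ ?N] mult_smult_assoc_mat[of _ ?N ?N _ ?N]
        mult_add_distrib_mat[of _ ?N ?N _ ?N] add_mult_distrib_mat[of _ ?N ?N _ _ ?N])
  have gpg: "g * pauli_projector n g 1 = pauli_projector n g 1" if "g \<in> set gs" for g
  proof -
    have "g * pauli_projector n g 1 = (1 / 2) \<cdot>\<^sub>m (g + g * g)"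
      using gc[OF that] unfolding pauli_projector_def
      by (simp add: mult_smult_distrib[of _ ?N ?N _ ?N] mult_add_distrib_mat[of _ ?N ?N _ ?N])
    also have "g * g = 1\<^sub>m ?N" using that gs by (auto intro: paulis_square)
    finally show ?thesis using gc[OF that] unfolding pauli_projector_def 
      by (simp add: comm_add_mat[of _ ?N ?N])
  qed
  \<comment> \<open>\<open>g\<close> commutes past the projectors in front of its own, and its own
    projector absorbs it.\<close>
  have gQ: "g * Q hs = Q hs" if "set hs \<subseteq> set gs" "g \<in> set hs" for g hs
    using that
  proof (induction hs)
    case (Cons h hs)
    then have m: "g \<in> set gs" "h \<in> set gs" "set hs \<subseteq> set gs" by auto
    note cs = gc[OF m(1)] pc[OF m(2)] Qc[OF m(3)]
    have eq: "g * Q (h # hs) = (g * pauli_projector n h 1) * Q hs" using cs by simp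
    show ?case
    proof (cases "g = h")
      case True
      then show ?thesis unfolding eq using gpg[OF m(1)] by simp
    next
      case False
      then have "g * Q hs = Q hs" using Cons m by auto
      then show ?thesis unfolding eq gp[OF m(1,2)] using cs by simp
    qed
  qed simp
  \<comment> \<open>The adjoint is treated as well, since below \<open>Q gs\<close> is moved to the
    other side of an inner product with \<open>v\<close>.\<close>
  have Qv: "Q hs *\<^sub>v v = v" "mat_adjoint (Q hs) *\<^sub>v v = v" if "set hs \<subseteq> set gs" for hs
  proof -
    have pv: "pauli_projector n g 1 *\<^sub>v v = v" "mat_adjoint (pauli_projector n g 1) *\<^sub>v v = v" if "g \<in> set gs" for g
    proof -
      have gP: "g \<in> paulis n" using that gs by auto
      have "g *\<^sub>v v = 1 \<cdot>\<^sub>v v" using stab[OF that] by simp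
      from pauli_projector_mult_eigenvector[OF gP v(1) this, of 1] show "pauli_projector n g 1 *\<^sub>v v = v" by simp
      then show "mat_adjoint (pauli_projector n g 1) *\<^sub>v v = v" by (simp add: pauli_projector_adjoint[OF gP])
    qed
    show "Q hs *\<^sub>v v = v" using that
    proof (induction hs)
      case (Cons h hs)
      then show ?case using assoc_mult_mat_vec[OF pc[of h] Qc[of hs] v(1)] by (simp add: pv)
    qed (use v in simp)
    show "mat_adjoint (Q hs) *\<^sub>v v = v" using that
    proof (induction hs)
      case (Cons h hs)
      then have m: "h \<in> set gs" "set hs \<subseteq> set gs" by auto
      show ?case
        using Cons assoc_mult_mat_vec[OF mat_adjoint_carrier[OF Qc[OF m(2)]] mat_adjoint_carrier[OF pc[OF m(1)]] v(1)] m
        by (simp add: pv mat_adjoint_mult[OF pc[OF m(1)] Qc[OF m(2)]])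
    qed (use v in simp)
  qed
  \<comment> \<open>Every vector in the range of \<open>Q gs\<close> is fixed by all generators,
    hence lies on the line through \<open>v\<close> by uniqueness of the stabilizer state.\<close>
  have Qproj: "Q gs *\<^sub>v w = proj v *\<^sub>v w" if w: "w \<in> carrier_vec ?N" for w
  proof -
    let ?x = "Q gs *\<^sub>v w"
    have x: "?x \<in> carrier_vec ?N" using Qc[of gs] w by auto
    have fixed: "g *\<^sub>v ?x = ?x" if "g \<in> set gs" for g
      using assoc_mult_mat_vec[OF gc[OF that] Qc[OF subset_refl] w] gQ[OF subset_refl that] by simp
    \<comment> \<open>Uniqueness speaks of normalized vectors only, so the zero vector is treated
      apart and any other vector is rescaled.\<close>
    obtain c where c: "?x = c \<cdot>\<^sub>v v"
    proof (cases "?x = 0\<^sub>v ?N")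
      case True
      then have "?x = 0 \<cdot>\<^sub>v v" using v by auto
      then show ?thesis by (rule that)
    next
      case False
      then have pos: "0 < ?x \<bullet>c ?x" using conjugate_square_greater_0_vec[OF x] by simp
      define r where "r = 1 / sqrt (Re (?x \<bullet>c ?x))"
      have im: "Im (?x \<bullet>c ?x) = 0" and re: "Re (?x \<bullet>c ?x) > 0" using pos by (auto simp: less_complex_def)
      have r: "r \<noteq> 0" "r * r * Re (?x \<bullet>c ?x) = 1" using re by (auto simp: r_def field_simps)
      have "(complex_of_real r \<cdot>\<^sub>v ?x) \<bullet>c (complex_of_real r \<cdot>\<^sub>v ?x) = complex_of_real (r * r) * (?x \<bullet>c ?x)"
        using x by (simp add: conjugate_smult_vec)
      also have "\<dots> = complex_of_real (r * r * Re (?x \<bullet>c ?x))"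
        using im by (simp add: complex_eq_iff)
      finally have "normalized (complex_of_real r \<cdot>\<^sub>v ?x)" by (simp add: normalized_def r)
      moreover have "g *\<^sub>v (complex_of_real r \<cdot>\<^sub>v ?x) = complex_of_real r \<cdot>\<^sub>v ?x" if "g \<in> set gs" for g
        using mult_mat_vec[OF gc[OF that] x] fixed[OF that] by simp
      ultimately obtain c where "complex_of_real r \<cdot>\<^sub>v ?x = c \<cdot>\<^sub>v v" using uniq[of "complex_of_real r \<cdot>\<^sub>v ?x"] x by auto
      then have "complex_of_real (1/r) \<cdot>\<^sub>v (complex_of_real r \<cdot>\<^sub>v ?x) = complex_of_real (1/r) \<cdot>\<^sub>v (c \<cdot>\<^sub>v v)" by simp
      then have "?x = (complex_of_real (1/r) * c) \<cdot>\<^sub>v v" using r(1) by (simp add: smult_smult_assoc)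
      then show ?thesis by (rule that)
    qed
    \<comment> \<open>Pairing with the unit vector \<open>v\<close> reads off the coefficient, and
      the adjoint of \<open>Q gs\<close> fixes \<open>v\<close>.\<close>
    have "c = ?x \<bullet>c v" using c v by (simp add: normalized_def)
    also have "\<dots> = w \<bullet>c v" using mat_mult_cscalar_prod[OF Qc w v(1)] Qv(2) by simp
    finally show ?thesis using c proj_mult_vec[OF v(1) w] by simp
  qed
  have "Q gs = proj v"
  proof (rule eq_matI)
    fix i j assume "i < dim_row (proj v)" "j < dim_col (proj v)"
    then have ij: "i < ?N" "j < ?N" using v by (auto simp: proj_def)
    have ent: "A $$ (i, j) = (A *\<^sub>v unit_vec ?N j) $ i" if "A \<in> carrier_mat ?N ?N" for A :: "complex mat"
      using that ij by simp
    show "Q gs $$ (i, j) = proj v $$ (i, j)"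
      using ent[OF Qc] ent[OF proj_carrier[OF v(1)]] Qproj[of "unit_vec ?N j"] by simp
  qed (use v Qc[of gs] in \<open>auto simp: proj_def\<close>)
  then show ?thesis using Qg[of gs] by simp
qed

section \<open>Positive semidefinite matrices and traces\<close>

definition quad_form :: "complex mat \<Rightarrow> complex vec \<Rightarrow> complex" where
  "quad_form A u = (A *\<^sub>v u) \<bullet>c u"

text \<open>In the order on the complex numbers, being nonnegative includes being real. The
  condition therefore covers Hermiticity, which needs no clause of its own.\<close>

definition psd :: "nat \<Rightarrow> complex mat \<Rightarrow> bool" where
  "psd n A \<longleftrightarrow> A \<in> carrier_mat n n \<and> (\<forall>u\<in>carrier_vec n. 0 \<le> quad_form A u)"

lemma psd_carrier: "psd n A \<Longrightarrow> A \<in> carrier_mat n n"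
  by (simp add: psd_def)

lemma quad_form_sum:
  assumes "A \<in> carrier_mat n n" "u \<in> carrier_vec n"
  shows "quad_form A u = (\<Sum>i<n. \<Sum>j<n. A $$ (i, j) * u $ j * cnj (u $ i))"
  unfolding quad_form_def using assms
  by (subst cscalar_prod_sum[of _ n])
    (auto simp: mult_mat_vec_index_sum[OF assms] sum_distrib_right simp del: index_mult_mat_vec)

lemma quad_form_add:
  assumes "A \<in> carrier_mat n n" "B \<in> carrier_mat n n" "u \<in> carrier_vec n"
  shows "quad_form (A + B) u = quad_form A u + quad_form B u"
  using assms by (simp add: quad_form_sum[of _ n] algebra_simps sum.distrib)

lemma quad_form_smult:
  assumes "A \<in> carrier_mat n n" "u \<in> carrier_vec n"
  shows "quad_form (c \<cdot>\<^sub>m A) u = c * quad_form A u"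
  using assms by (simp add: quad_form_sum[of _ n] algebra_simps sum_distrib_left)

lemma quad_form_conj:
  assumes K: "K \<in> carrier_mat n m" and A: "A \<in> carrier_mat m m" and u: "u \<in> carrier_vec n"
  shows "quad_form (K * A * mat_adjoint K) u = quad_form A (mat_adjoint K *\<^sub>v u)"
proof -
  note K' = mat_adjoint_carrier[OF K]
  have "K * A * mat_adjoint K *\<^sub>v u = K *\<^sub>v (A *\<^sub>v (mat_adjoint K *\<^sub>v u))"
    using assms K' mult_mat_vec_carrier[OF K' u]
    by (simp add: assoc_mult_mat_vec[OF mult_carrier_mat[OF K A] K' u] assoc_mult_mat_vec[OF K A])
  then show ?thesis
    unfolding quad_form_def
    using mat_mult_cscalar_prod[OF K mult_mat_vec_carrier[OF A mult_mat_vec_carrier[OF K' u]] u] by simp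
qed

lemma psd_conj:
  assumes K: "K \<in> carrier_mat n m" and A: "psd m A"
  shows "psd n (K * A * mat_adjoint K)"
  unfolding psd_def
proof (intro conjI ballI)
  note c = psd_carrier[OF A]
  show "K * A * mat_adjoint K \<in> carrier_mat n n" using K c by (meson mat_adjoint_carrier mult_carrier_mat)
  fix u :: "complex vec" assume u: "u \<in> carrier_vec n"
  show "0 \<le> quad_form (K * A * mat_adjoint K) u"
    unfolding quad_form_conj[OF K c u]
    using A mult_mat_vec_carrier[OF mat_adjoint_carrier[OF K] u] by (simp add: psd_def)
qed

lemma psd_add: "psd n A \<Longrightarrow> psd n B \<Longrightarrow> psd n (A + B)"
  by (auto simp: psd_def quad_form_add)

lemma psd_smult: "0 \<le> r \<Longrightarrow> psd n A \<Longrightarrow> psd n (complex_of_real r \<cdot>\<^sub>m A)"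
  by (auto simp: psd_def quad_form_smult less_eq_complex_def)

lemma psd_zero: "psd n (0\<^sub>m n n)"
  by (auto simp: psd_def quad_form_sum[of _ n])

definition trace :: "complex mat \<Rightarrow> complex" where
  "trace A = (\<Sum>i<dim_row A. A $$ (i, i))"

lemma trace_mult_commute:
  assumes A: "A \<in> carrier_mat n m" and B: "B \<in> carrier_mat m n"
  shows "trace (A * B) = trace (B * A)"
proof -
  have "trace (A * B) = (\<Sum>i<n. \<Sum>l<m. A $$ (i, l) * B $$ (l, i))"
    using A unfolding trace_def by (auto simp: mult_mat_index_sum[OF A B] simp del: index_mult_mat(1))
  also have "\<dots> = (\<Sum>l<m. \<Sum>i<n. B $$ (l, i) * A $$ (i, l))"
    by (subst sum.swap) (simp add: mult.commute)
  also have "\<dots> = trace (B * A)"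
    using B unfolding trace_def by (auto simp: mult_mat_index_sum[OF B A] simp del: index_mult_mat(1))
  finally show ?thesis .
qed

lemma trace_conj:
  assumes K: "K \<in> carrier_mat n m" and A: "A \<in> carrier_mat m m"
  shows "trace (K * A * mat_adjoint K) = trace (mat_adjoint K * K * A)"
proof -
  note K' = mat_adjoint_carrier[OF K]
  have "trace (K * A * mat_adjoint K) = trace (mat_adjoint K * (K * A))"
    by (rule trace_mult_commute[OF mult_carrier_mat[OF K A] K'])
  also have "mat_adjoint K * (K * A) = mat_adjoint K * K * A"
    using assoc_mult_mat[OF K' K A] by simp
  finally show ?thesis .
qed

lemma trace_conj_isometry:
  assumes "K \<in> carrier_mat n m" "A \<in> carrier_mat m m" "mat_adjoint K * K = 1\<^sub>m m"
  shows "trace (K * A * mat_adjoint K) = trace A"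
  using assms by (simp add: trace_conj)

text \<open>Appending the pure state \<open>v\<close> is conjugation by V = 1 tensor v, with
  \<open>v\<close> read as a column, and V is an isometry when \<open>v\<close> is normalized.
  Positivity and trace of the enlarged state thus follow from the facts about conjugations.\<close>

lemma tensor_mat_proj:
  assumes A: "A \<in> carrier_mat n n" and v: "v \<in> carrier_vec m"
  obtains V where "V \<in> carrier_mat (n * m) n" "tensor_mat A (proj v) = V * A * mat_adjoint V"
    "normalized v \<Longrightarrow> mat_adjoint V * V = 1\<^sub>m n"
proof
  define W where "W = mat m 1 (\<lambda>(i, j). v $ i)"
  have W: "W \<in> carrier_mat m 1" by (simp add: W_def)
  note W' = mat_adjoint_carrier[OF W]
  let ?I = "1\<^sub>m n :: complex mat" and ?V = "tensor_mat (1\<^sub>m n) W"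
  have I: "?I \<in> carrier_mat n n" by simp
  show "?V \<in> carrier_mat (n * m) n" using tensor_mat_carrier[OF I W] by simp
  have pW: "proj v = W * mat_adjoint W"
  proof (rule eq_matI)
    fix i j assume "i < dim_row (W * mat_adjoint W)" "j < dim_col (W * mat_adjoint W)"
    then have ij: "i < m" "j < m" using W by auto
    show "proj v $$ (i, j) = (W * mat_adjoint W) $$ (i, j)"
      unfolding mult_mat_index_sum[OF W W' ij] using ij v by (simp add: W_def)
  qed (use v in \<open>auto simp: W_def proj_def\<close>)
  \<comment> \<open>Writing \<open>A\<close> as its tensor product with \<open>1\<^sub>m 1\<close>
    makes all three factors tensor products, so the mixed-product rule applies.\<close>
  have "?V * A * mat_adjoint ?V = tensor_mat ?I W * tensor_mat A (1\<^sub>m 1) * tensor_mat ?I (mat_adjoint W)"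
    by (simp add: tensor_mat_adjoint)
  also have "\<dots> = tensor_mat (?I * A * ?I) (W * 1\<^sub>m 1 * mat_adjoint W)"
  proof -
    have c: "?I * A \<in> carrier_mat n n" "W * 1\<^sub>m 1 \<in> carrier_mat m 1" using A W by auto
    show ?thesis
      unfolding tensor_mat_mult[OF I A W one_carrier_mat] tensor_mat_mult[OF c(1) I c(2) W'] ..
  qed
  also have "\<dots> = tensor_mat A (proj v)" using A W by (simp add: pW)
  finally show "tensor_mat A (proj v) = ?V * A * mat_adjoint ?V" ..
  assume nv: "normalized v"
  have "mat_adjoint W * W = 1\<^sub>m 1"
  proof (rule eq_matI)
    fix i j assume "i < dim_row (1\<^sub>m 1 :: complex mat)" "j < dim_col (1\<^sub>m 1 :: complex mat)"
    then have ij: "i < 1" "j < 1" by auto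
    have "(\<Sum>l<m. v $ l * cnj (v $ l)) = 1" using nv v by (simp add: normalized_def cscalar_prod_sum)
    then show "(mat_adjoint W * W) $$ (i, j) = 1\<^sub>m 1 $$ (i, j)"
      unfolding mult_mat_index_sum[OF W' W ij] using ij by (simp add: W_def mult.commute)
  qed (use W in auto)
  then show "mat_adjoint ?V * ?V = 1\<^sub>m n"
    unfolding tensor_mat_adjoint mat_adjoint_one by (subst tensor_mat_mult[OF I I W' W]) simp
qed

lemma psd_tensor_proj:
  assumes A: "psd n A" and v: "v \<in> carrier_vec m"
  shows "psd (n * m) (tensor_mat A (proj v))"
proof -
  obtain V where "V \<in> carrier_mat (n * m) n" "tensor_mat A (proj v) = V * A * mat_adjoint V"
    by (rule tensor_mat_proj[OF psd_carrier[OF A] v])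
  then show ?thesis using A by (simp only: psd_conj)
qed

lemma trace_tensor_proj:
  assumes A: "A \<in> carrier_mat n n" and v: "v \<in> carrier_vec m" "normalized v"
  shows "trace (tensor_mat A (proj v)) = trace A"
proof -
  obtain V where "V \<in> carrier_mat (n * m) n" "tensor_mat A (proj v) = V * A * mat_adjoint V"
    "mat_adjoint V * V = 1\<^sub>m n"
    using tensor_mat_proj[OF A v(1)] v(2) by metis
  then show ?thesis using A by (simp only: trace_conj_isometry)
qed

lemma partial_trace_carrier [simp]: "partial_trace n k A \<in> carrier_mat (2 ^ n) (2 ^ n)"
  by (simp add: partial_trace_def)

lemma trace_partial_trace:
  assumes "A \<in> carrier_mat (2 ^ (n + k)) (2 ^ (n + k))"
  shows "trace (partial_trace n k A) = trace A"
  using assms by (auto simp: trace_def partial_trace_def power_add sum_lessThan_mult)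

text \<open>Fixing a basis vector on the discarded factor singles out one diagonal block. Summed
  over \<open>l\<close>, this expresses the quadratic form of a partial trace by values of the form
  of \<open>A\<close>, so that positivity survives discarding.\<close>

lemma quad_form_tensor_unit_vec:
  assumes A: "A \<in> carrier_mat (N * K) (N * K)" and u: "u \<in> carrier_vec N" and l: "l < K"
  shows "quad_form A (tensor_vec u (unit_vec K l)) =
    (\<Sum>i<N. \<Sum>j<N. A $$ (i * K + l, j * K + l) * u $ j * cnj (u $ i))"
proof -
  let ?G = "\<lambda>i a j b. A $$ (i * K + a, j * K + b) * u $ j * cnj (u $ i)"
  have t: "tensor_vec u (unit_vec K l) \<in> carrier_vec (N * K)" using u by simp
  have ix: "tensor_vec u (unit_vec K l) $ (j * K + b) = (if b = l then u $ j else 0)" if "j < N" "b < K" for j b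
    using u l that by (simp add: mult_add_less)
  have "quad_form A (tensor_vec u (unit_vec K l)) = 
     (\<Sum>i<N. \<Sum>a<K. \<Sum>j<N. \<Sum>b<K. if a = l then if b = l then ?G i a j b else 0 else 0)"
    unfolding quad_form_sum[OF A t] sum_lessThan_mult by (intro sum.cong refl) (simp add: ix)
  also have "\<dots> = (\<Sum>i<N. \<Sum>a<K. if a = l then \<Sum>j<N. \<Sum>b<K. if b = l then ?G i a j b else 0 else 0)"
    by (rule sum.cong[OF refl], rule sum.cong[OF refl]) simp
  also have "\<dots> = (\<Sum>i<N. \<Sum>j<N. ?G i l j l)"
    using l by (simp add: sum.delta)
  finally show ?thesis .
qed

lemma quad_form_partial_trace:
  assumes A: "A \<in> carrier_mat (2 ^ (n + k)) (2 ^ (n + k))" and u: "u \<in> carrier_vec (2 ^ n)"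
  shows "quad_form (partial_trace n k A) u = (\<Sum>l<2^k. quad_form A (tensor_vec u (unit_vec (2 ^ k) l)))"
proof -
  let ?N = "2 ^ n :: nat" and ?K = "2 ^ k :: nat"
  have A': "A \<in> carrier_mat (?N * ?K) (?N * ?K)" using A by (simp add: power_add)
  have "(\<Sum>l<?K. quad_form A (tensor_vec u (unit_vec ?K l))) = 
      (\<Sum>l<?K. \<Sum>i<?N. \<Sum>j<?N. A $$ (i * ?K + l, j * ?K + l) * u $ j * cnj (u $ i))"
    by (rule sum.cong[OF refl], rule quad_form_tensor_unit_vec[OF A' u]) simp
  also have "\<dots> = (\<Sum>i<?N. \<Sum>j<?N. \<Sum>l<?K. A $$ (i * ?K + l, j * ?K + l) * u $ j * cnj (u $ i))"
    by (subst sum.swap, rule sum.cong[OF refl], rule sum.swap)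
  also have "\<dots> = quad_form (partial_trace n k A) u"
    unfolding quad_form_sum[OF partial_trace_carrier u]
    by (intro sum.cong refl) (simp add: partial_trace_def sum_distrib_right)
  finally show ?thesis ..
qed

lemma psd_partial_trace:
  assumes "psd (2 ^ (n + k)) A"
  shows "psd (2 ^ n) (partial_trace n k A)"
proof -
  have "tensor_vec u (unit_vec (2 ^ k) l) \<in> carrier_vec (2 ^ (n + k))" if "u \<in> carrier_vec (2 ^ n)" for u l
    using tensor_vec_carrier[OF that unit_vec_carrier] by (simp add: power_add)
  then show ?thesis
    using assms unfolding psd_def by (auto simp: quad_form_partial_trace intro!: sum_nonneg)
qed

section \<open>Clifford protocols as positive linear maps\<close>

text \<open>Unnormalised convex mixtures, for an induction on the number of terms.\<close>

definition mixture :: "nat \<Rightarrow> (nat \<Rightarrow> real) \<Rightarrow> (nat \<Rightarrow> complex vec) \<Rightarrow> nat \<Rightarrow> complex mat" where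
  "mixture n p v k = mat (2^n) (2^n) (\<lambda>(i, j). \<Sum>l<k. complex_of_real (p l) * proj (v l) $$ (i, j))"

lemma mixture_carrier [simp]: "mixture n p v k \<in> carrier_mat (2 ^ n) (2 ^ n)"
  by (simp add: mixture_def)

text \<open>The matrix is zero, but the equation is phrased as a multiple of itself so that
  homogeneity of a protocol shows that its image vanishes too.\<close>

lemma tensor_mixture_0:
  "A \<in> carrier_mat N N \<Longrightarrow> tensor_mat A (mixture n p v 0) = complex_of_real 0 \<cdot>\<^sub>m tensor_mat A (mixture n p v 0)"
  by (intro eq_matI) (auto simp: mixture_def less_mult_div_mod)

lemma tensor_mixture_Suc:
  assumes "A \<in> carrier_mat N N" "v k \<in> carrier_vec (2 ^ n)"
  shows "tensor_mat A (mixture n p v (Suc k)) = 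
    tensor_mat A (mixture n p v k) + complex_of_real (p k) \<cdot>\<^sub>m tensor_mat A (proj (v k))"
  using assms by (intro eq_matI) (auto simp: mixture_def less_mult_div_mod algebra_simps proj_def)

lemma stabilizer_stateE:
  assumes "stabilizer_state n \<sigma>"
  obtains k p v where "\<And>l. l < k \<Longrightarrow> 0 \<le> p l" "\<And>l. l < k \<Longrightarrow> pure_stabilizer n (v l)"
    "(\<Sum>l<k. p l) = 1" "\<sigma> = mixture n p v k"
  using assms unfolding stabilizer_state_def mixture_def by blast

lemma pure_stabilizer_carrier: "pure_stabilizer n v \<Longrightarrow> v \<in> carrier_vec (2 ^ n)"
  and pure_stabilizer_normalized: "pure_stabilizer n v \<Longrightarrow> normalized v"
  by (simp_all add: pure_stabilizer_def)

lemma psd_tensor_mixture: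
  assumes A: "psd N A" and "\<And>l. l < k \<Longrightarrow> 0 \<le> p l" "\<And>l. l < k \<Longrightarrow> v l \<in> carrier_vec (2 ^ n)"
  shows "psd (N * 2 ^ n) (tensor_mat A (mixture n p v k))"
  using assms(2,3)
proof (induction k)
  case 0
  have "tensor_mat A (mixture n p v 0) = 0\<^sub>m (N * 2 ^ n) (N * 2 ^ n)"
    using psd_carrier[OF A] by (intro eq_matI) (auto simp: mixture_def less_mult_div_mod)
  then show ?case by (simp add: psd_zero)
next
  case (Suc k)
  then show ?case
    using psd_carrier[OF A] by (auto simp: tensor_mixture_Suc intro!: psd_add psd_smult psd_tensor_proj A)
qed

lemma partial_trace_add:
  assumes "A \<in> carrier_mat (2 ^ (n + k)) (2 ^ (n + k))" "B \<in> carrier_mat (2 ^ (n + k)) (2 ^ (n + k))"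
  shows "partial_trace n k (A + B) = partial_trace n k A + partial_trace n k B"
  using assms by (intro eq_matI) (auto simp: partial_trace_def mult_add_less power_add sum.distrib)

lemma partial_trace_smult:
  assumes "A \<in> carrier_mat (2 ^ (n + k)) (2 ^ (n + k))"
  shows "partial_trace n k (c \<cdot>\<^sub>m A) = c \<cdot>\<^sub>m partial_trace n k A"
  using assms by (intro eq_matI) (auto simp: partial_trace_def mult_add_less power_add sum_distrib_left)

lemma conj_add:
  assumes "K \<in> carrier_mat n n" "L \<in> carrier_mat n n" "A \<in> carrier_mat n n" "B \<in> carrier_mat n n"
  shows "K * (A + B) * L = K * A * L + K * B * (L :: complex mat)"
proof -
  have "K * A \<in> carrier_mat n n" "K * B \<in> carrier_mat n n" using assms by auto
  then show ?thesis using assms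
    by (simp add: mult_add_distrib_mat[of _ n n _ n] add_mult_distrib_mat[of _ n n _ _ n])
qed

lemma conj_smult:
  assumes "K \<in> carrier_mat n n" "L \<in> carrier_mat n n" "A \<in> carrier_mat n n"
  shows "K * (c \<cdot>\<^sub>m A) * L = c \<cdot>\<^sub>m (K * A * (L :: complex mat))"
proof -
  have "K * A \<in> carrier_mat n n" using assms by auto
  then show ?thesis using assms
    by (simp add: mult_smult_distrib[of _ n n _ n] mult_smult_assoc_mat[of _ n n _ n])
qed

lemma conj_carrier:
  "K \<in> carrier_mat n n \<Longrightarrow> L \<in> carrier_mat n n \<Longrightarrow> A \<in> carrier_mat n n \<Longrightarrow> K * A * L \<in> carrier_mat n n"
  by simp

lemma stabilizer_state_carrier: "stabilizer_state n \<sigma> \<Longrightarrow> \<sigma> \<in> carrier_mat (2 ^ n) (2 ^ n)"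
  by (auto simp: stabilizer_state_def)

lemma smult_add_distrib_mat: 
  "A \<in> carrier_mat n m \<Longrightarrow> B \<in> carrier_mat n m \<Longrightarrow> c \<cdot>\<^sub>m (A + B) = c \<cdot>\<^sub>m A + c \<cdot>\<^sub>m (B :: complex mat)"
  by (intro eq_matI) (auto simp: algebra_simps)

text \<open>The three claims go through one induction, since rearranging the sums of the branches
  requires the outputs of the continuations to have the right dimensions. Linearity serves to split
  a mixed preparation into pure ones.\<close>

lemma clifford_protocol_linear:
  assumes "clifford_protocol n m E"
  shows "(\<forall>A\<in>carrier_mat (2 ^ n) (2 ^ n). E A \<in> carrier_mat (2 ^ m) (2 ^ m)) \<and>
    (\<forall>A\<in>carrier_mat (2 ^ n) (2 ^ n). \<forall>B\<in>carrier_mat (2 ^ n) (2 ^ n). E (A + B) = E A + E B) \<and>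
    (\<forall>A\<in>carrier_mat (2 ^ n) (2 ^ n). \<forall>c. E (c \<cdot>\<^sub>m A) = c \<cdot>\<^sub>m E A)"
  using assms
proof induction
  case (finish n)
  then show ?case by auto
next
  case (unitary C n m E)
  note C = clifford_group_carrier[OF unitary(1)]
  note c = C mat_adjoint_carrier[OF C]
  then show ?case using unitary(3) by (simp add: conj_add[OF c] conj_smult[OF c] conj_carrier[OF c] del: mult_carrier_mat)
next
  case (prepare k \<sigma> n m E)
  note s = stabilizer_state_carrier[OF prepare(1)]
  have c: "tensor_mat A \<sigma> \<in> carrier_mat (2 ^ (n + k)) (2 ^ (n + k))" if "A \<in> carrier_mat (2 ^ n) (2 ^ n)" for A
    using tensor_mat_carrier[OF that s] by (simp add: power_add)
  then show ?case using prepare(3) by (auto simp: tensor_mat_add_left[of _ "2^n" "2^n"] tensor_mat_smult_left)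
next
  case (discard n m E k)
  then show ?case by (auto simp: partial_trace_add partial_trace_smult)
next
  case (measure P n m E1 E2)
  note c = pauli_projector_carrier[OF measure(1)]
  note l1 = measure(4) and l2 = measure(5)
  show ?case
  proof (intro conjI ballI allI)
    fix A :: "complex mat" assume A: "A \<in> carrier_mat (2 ^ n) (2 ^ n)"
    note cA = conj_carrier[OF c c A]
    show "E1 (pauli_projector n P 1 * A * pauli_projector n P 1) + E2 (pauli_projector n P (- 1) * A * pauli_projector n P (- 1)) \<in> carrier_mat (2 ^ m) (2 ^ m)"
      using l1 l2 cA by auto
    show "E1 (pauli_projector n P 1 * (r \<cdot>\<^sub>m A) * pauli_projector n P 1) + E2 (pauli_projector n P (- 1) * (r \<cdot>\<^sub>m A) * pauli_projector n P (- 1)) 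
      = r \<cdot>\<^sub>m (E1 (pauli_projector n P 1 * A * pauli_projector n P 1) + E2 (pauli_projector n P (- 1) * A * pauli_projector n P (- 1)))" for r
      unfolding conj_smult[OF c c A] using l1 l2 cA by (simp add: smult_add_distrib_mat[of _ "2^m" "2^m"])
    fix B :: "complex mat" assume B: "B \<in> carrier_mat (2 ^ n) (2 ^ n)"
    note cB = conj_carrier[OF c c B]
    let ?c = "\<lambda>s A. pauli_projector n P s * A * pauli_projector n P s"
    have "E1 (?c 1 (A + B)) = E1 (?c 1 A) + E1 (?c 1 B)" "E2 (?c (-1) (A + B)) = E2 (?c (-1) A) + E2 (?c (-1) B)"
      unfolding conj_add[OF c c A B] using l1 l2 cA cB by auto
    moreover have "E1 (?c 1 A) \<in> carrier_mat (2 ^ m) (2 ^ m)" "E1 (?c 1 B) \<in> carrier_mat (2 ^ m) (2 ^ m)"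
      "E2 (?c (-1) A) \<in> carrier_mat (2 ^ m) (2 ^ m)" "E2 (?c (-1) B) \<in> carrier_mat (2 ^ m) (2 ^ m)"
      using l1 l2 cA cB by auto
    ultimately show "E1 (?c 1 (A + B)) + E2 (?c (-1) (A + B)) = E1 (?c 1 A) + E2 (?c (-1) A) + (E1 (?c 1 B) + E2 (?c (-1) B))"
      by (intro eq_matI) auto
  qed
next
  case (randomize p n m E1 E2)
  note l1 = randomize(5) and l2 = randomize(6)
  show ?case
  proof (intro conjI ballI allI)
    fix A :: "complex mat" assume A: "A \<in> carrier_mat (2 ^ n) (2 ^ n)"
    show "complex_of_real p \<cdot>\<^sub>m E1 A + complex_of_real (1 - p) \<cdot>\<^sub>m E2 A \<in> carrier_mat (2 ^ m) (2 ^ m)"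
      using l1 l2 A by auto
    show "complex_of_real p \<cdot>\<^sub>m E1 (r \<cdot>\<^sub>m A) + complex_of_real (1 - p) \<cdot>\<^sub>m E2 (r \<cdot>\<^sub>m A)
      = r \<cdot>\<^sub>m (complex_of_real p \<cdot>\<^sub>m E1 A + complex_of_real (1 - p) \<cdot>\<^sub>m E2 A)" for r
      using l1 l2 A by (simp add: smult_add_distrib_mat[of _ "2^m" "2^m"] mult.commute)
    fix B :: "complex mat" assume B: "B \<in> carrier_mat (2 ^ n) (2 ^ n)"
    have "E1 (A + B) = E1 A + E1 B" "E2 (A + B) = E2 A + E2 B" using l1 l2 A B by auto
    moreover have "E1 A \<in> carrier_mat (2 ^ m) (2 ^ m)" "E1 B \<in> carrier_mat (2 ^ m) (2 ^ m)"
      "E2 A \<in> carrier_mat (2 ^ m) (2 ^ m)" "E2 B \<in> carrier_mat (2 ^ m) (2 ^ m)" using l1 l2 A B by auto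
    ultimately show "complex_of_real p \<cdot>\<^sub>m E1 (A + B) + complex_of_real (1 - p) \<cdot>\<^sub>m E2 (A + B)
      = complex_of_real p \<cdot>\<^sub>m E1 A + complex_of_real (1 - p) \<cdot>\<^sub>m E2 A
      + (complex_of_real p \<cdot>\<^sub>m E1 B + complex_of_real (1 - p) \<cdot>\<^sub>m E2 B)"
      by (intro eq_matI) (auto simp: algebra_simps)
  qed
qed

lemmas clifford_protocol_carrier = clifford_protocol_linear[THEN conjunct1, rule_format]
  and clifford_protocol_add = clifford_protocol_linear[THEN conjunct2, THEN conjunct1, rule_format]
  and clifford_protocol_smult = clifford_protocol_linear[THEN conjunct2, THEN conjunct2, rule_format]

lemma psd_pauli_projector_conj:
  assumes "P \<in> paulis n" "s \<in> {1, -1}" "psd (2 ^ n) A"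
  shows "psd (2 ^ n) (pauli_projector n P s * A * pauli_projector n P s)"
  using psd_conj[OF pauli_projector_carrier[OF assms(1)] assms(3), of s] pauli_projector_adjoint[OF assms(1,2)]
  by simp

text \<open>Each step is a conjugation, a partial trace or a preparation, and branches are combined
  with nonnegative weights. All of these preserve positivity.\<close>

lemma clifford_protocol_psd:
  "clifford_protocol n m E \<Longrightarrow> psd (2 ^ n) A \<Longrightarrow> psd (2 ^ m) (E A)"
proof (induction arbitrary: A rule: clifford_protocol.induct)
  case (unitary C n m E)
  then show ?case by (auto intro: psd_conj clifford_group_carrier)
next
  case (prepare k \<sigma> n m E)
  from prepare(1) obtain K p v where "\<And>l. l < K \<Longrightarrow> 0 \<le> p l" "\<And>l. l < K \<Longrightarrow> pure_stabilizer k (v l)"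
    "\<sigma> = mixture k p v K" by (rule stabilizer_stateE) blast
  then have "psd (2 ^ n * 2 ^ k) (tensor_mat A \<sigma>)"
    by (auto intro!: psd_tensor_mixture prepare.prems pure_stabilizer_carrier)
  then show ?case using prepare.IH by (simp add: power_add)
next
  case (discard n m E k)
  then show ?case by (auto intro: psd_partial_trace)
next
  case (measure P n m E1 E2)
  then show ?case by (auto intro!: psd_add psd_pauli_projector_conj)
next
  case (randomize p n m E1 E2)
  then show ?case by (intro psd_add psd_smult) auto
qed

text \<open>A mixture with irrational weights need not be Gaussian, but by linearity its
  contribution is the weighted sum of those of the pure states in it. The weights are left
  unconstrained, which lets the induction drop the last term.\<close>

lemma quad_form_protocol_mixture:
  assumes E: "clifford_protocol (n + k) m E" and A: "A \<in> carrier_mat (2 ^ n) (2 ^ n)"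
    and v: "\<And>l. l < K \<Longrightarrow> v l \<in> carrier_vec (2 ^ k)" and w: "w \<in> carrier_vec (2 ^ m)"
  shows "quad_form (E (tensor_mat A (mixture k p v K))) w =
    (\<Sum>l<K. complex_of_real (p l) * quad_form (E (tensor_mat A (proj (v l)))) w)"
  using v
proof (induction K)
  case 0
  have c: "tensor_mat A (mixture k p v 0) \<in> carrier_mat (2 ^ (n + k)) (2 ^ (n + k))"
    using tensor_mat_carrier[OF A mixture_carrier] by (simp add: power_add)
  have "E (tensor_mat A (mixture k p v 0)) = 0 \<cdot>\<^sub>m E (tensor_mat A (mixture k p v 0))"
    by (subst tensor_mixture_0[OF A], subst clifford_protocol_smult[OF E c]) simp
  then show ?case
    using quad_form_smult[OF clifford_protocol_carrier[OF E c] w, of 0] by simp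
next
  case (Suc K)
  have c: "tensor_mat A (mixture k p v K) \<in> carrier_mat (2 ^ (n + k)) (2 ^ (n + k))"
    "tensor_mat A (proj (v K)) \<in> carrier_mat (2 ^ (n + k)) (2 ^ (n + k))"
    using tensor_mat_carrier[OF A mixture_carrier] tensor_mat_carrier[OF A proj_carrier[of "v K"]] Suc.prems
    by (simp_all add: power_add)
  have "E (tensor_mat A (mixture k p v (Suc K))) =
      E (tensor_mat A (mixture k p v K)) + complex_of_real (p K) \<cdot>\<^sub>m E (tensor_mat A (proj (v K)))"
    using c Suc.prems A
    by (simp add: tensor_mixture_Suc clifford_protocol_add[OF E] clifford_protocol_smult[OF E])
  then show ?case
    using Suc c clifford_protocol_carrier[OF E] w
    by (simp add: quad_form_add[of _ "2^m"] quad_form_smult[of _ "2^m"])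
qed

section \<open>Impossibility without a catalyst\<close>

lemma ket_H0_carrier [simp]: "ket_H0 \<in> carrier_vec 2"
  by (auto simp: ket_H0_def intro: carrier_vecI)

lemma ket_H1_carrier [simp]: "ket_H1 \<in> carrier_vec 2"
  unfolding ket_H1_def by (rule mult_mat_vec_carrier[of _ 2 2]) auto

lemma ket_H_dim [simp]: "dim_vec ket_H0 = 2" "dim_vec ket_H1 = 2"
  using ket_H0_carrier ket_H1_carrier by (auto simp del: ket_H0_carrier ket_H1_carrier)

lemma ket_H0_index [simp]:
  "ket_H0 $ 0 = complex_of_real (cos (pi / 8))" "ket_H0 $ Suc 0 = complex_of_real (sin (pi / 8))"
  by (auto simp: ket_H0_def)

lemma ket_H1_index [simp]:
  "ket_H1 $ 0 = - \<i> * complex_of_real (sin (pi / 8))" "ket_H1 $ Suc 0 = \<i> * complex_of_real (cos (pi / 8))"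
proof -
  have "ket_H1 $ i = pauli_Y $$ (i, 0) * ket_H0 $ 0 + pauli_Y $$ (i, Suc 0) * ket_H0 $ Suc 0" if "i < 2" for i
    unfolding ket_H1_def using that
    by (subst mult_mat_vec_index_sum[of pauli_Y 2 2 ket_H0 i]) (auto simp: sum_lessThan_2)
  then show "ket_H1 $ 0 = - \<i> * complex_of_real (sin (pi / 8))" "ket_H1 $ Suc 0 = \<i> * complex_of_real (cos (pi / 8))"
    by simp_all
qed

lemma cos_sin_pi_8:
  "cos (pi / 8) ^ 2 = 1 / 2 + sqrt 2 / 4" "sin (pi / 8) ^ 2 = 1 / 2 - sqrt 2 / 4"
  "cos (pi / 8) * sin (pi / 8) = sqrt 2 / 4"
proof -
  have p: "2 * (pi / 8) = pi / 4" by simp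
  note d = cos_double[of "pi / 8", unfolded p cos_45, symmetric] sin_double[of "pi / 8", unfolded p sin_45, symmetric]
  show "cos (pi / 8) ^ 2 = 1 / 2 + sqrt 2 / 4" "sin (pi / 8) ^ 2 = 1 / 2 - sqrt 2 / 4"
    "cos (pi / 8) * sin (pi / 8) = sqrt 2 / 4"
    using sin_cos_squared_add[of "pi / 8"] d by (linarith, linarith, simp add: mult.commute)
qed

text \<open>By the double-angle formulas this says cos(pi/4) = sin(pi/4). Read as a rule that
  eliminates the square of the cosine, it is the relation behind \<open>ghz_gaussian\<close> and the
  two eigenvector lemmas for \<open>parity_pauli\<close>.\<close>

lemma complex_cos_pi_8_square:
  "complex_of_real (cos (pi / 8)) * complex_of_real (cos (pi / 8)) = 
   2 * (complex_of_real (cos (pi / 8)) * complex_of_real (sin (pi / 8))) +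
   complex_of_real (sin (pi / 8)) * complex_of_real (sin (pi / 8))"
proof -
  have "cos (pi / 8) * cos (pi / 8) = 2 * (cos (pi / 8) * sin (pi / 8)) + sin (pi / 8) * sin (pi / 8)"
    using cos_sin_pi_8 unfolding power2_eq_square by linarith
  then have "complex_of_real (cos (pi / 8) * cos (pi / 8)) = 
      complex_of_real (2 * (cos (pi / 8) * sin (pi / 8)) + sin (pi / 8) * sin (pi / 8))" by (rule arg_cong)
  then show ?thesis by simp
qed

lemma sqrt_2_irrational: "sqrt 2 \<notin> \<rat>"
proof
  assume "sqrt 2 \<in> \<rat>"
  then obtain m n :: nat where mn: "n \<noteq> 0" "\<bar>sqrt 2\<bar> = real m / real n" "coprime m n"
    by (rule Rats_abs_nat_div_natE)
  then have "real m = sqrt 2 * real n" by (simp add: field_simps)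
  then have "real m ^ 2 = 2 * real n ^ 2" by (simp add: power_mult_distrib)
  then have eq: "m ^ 2 = 2 * n ^ 2" by (metis of_nat_eq_iff of_nat_mult of_nat_numeral of_nat_power)
  then have "even m" by (metis dvd_triv_left even_power)
  then obtain k where k: "m = 2 * k" by blast
  with eq have "n ^ 2 = 2 * k ^ 2" by (simp add: power_mult_distrib)
  then have "even n" by (metis dvd_triv_left even_power)
  with \<open>even m\<close> mn(3) show False by auto
qed

lemma rat_add_sqrt_2_mult_eq_0:
  assumes "a \<in> \<rat>" "b \<in> \<rat>" "a + sqrt 2 * b = 0"
  shows "a = 0"
proof (rule ccontr)
  assume "a \<noteq> 0"
  then have "b \<noteq> 0" using assms by auto
  then have "sqrt 2 = - a / b" using assms(3) by (simp add: field_simps)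
  then show False using sqrt_2_irrational assms by (metis Rats_divide Rats_minus_iff)
qed

text \<open>The projector onto \<open>ket_H1\<close> is (1 - H) / 2, so the form equals tr(A) / 2 -
  sqrt 2 tr(A (X + Z)) / 4. Both traces lie in Q(i), and 1 and sqrt 2 are independent over the
  rationals, in the real and in the imaginary part.\<close>

lemma trace_eq_0_if_quad_form_ket_H1_eq_0:
  assumes A: "A \<in> carrier_mat 2 2" "gaussian_mat A" and q: "quad_form A ket_H1 = 0"
  shows "trace A = 0"
proof -
  let ?c = "complex_of_real (cos (pi / 8))" and ?s = "complex_of_real (sin (pi / 8))"
  define a b c d where "a = A $$ (0, 0)" and "b = A $$ (0, 1)" and "c = A $$ (1, 0)" and "d = A $$ (1, 1)"
  note abcd = a_def b_def c_def d_def
  have g: "a \<in> gaussian_rats" "b \<in> gaussian_rats" "c \<in> gaussian_rats" "d \<in> gaussian_rats"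
    using A unfolding abcd by (auto intro!: gaussian_matD)
  have cs: "?c * ?c = complex_of_real (1 / 2 + sqrt 2 / 4)" "?s * ?s = complex_of_real (1 / 2 - sqrt 2 / 4)"
    "?c * ?s = complex_of_real (sqrt 2 / 4)"
    using cos_sin_pi_8 by (simp_all only: of_real_mult[symmetric] power2_eq_square)
  have "quad_form A ket_H1 = a * (?s * ?s) - b * (?c * ?s) - c * (?c * ?s) + d * (?c * ?c)"
    using A by (simp add: quad_form_sum[of _ 2] sum_lessThan_2 abcd algebra_simps)
  also have "\<dots> = (a + d) / 2 + complex_of_real (sqrt 2) * ((d - a - b - c) / 4)"
    unfolding cs by (simp add: field_simps)
  finally have eq: "(a + d) / 2 + complex_of_real (sqrt 2) * ((d - a - b - c) / 4) = 0" using q by simp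
  have "(a + d) / 2 \<in> gaussian_rats" "(d - a - b - c) / 4 \<in> gaussian_rats" using g by auto
  then have r: "Re ((a + d) / 2) \<in> \<rat>" "Re ((d - a - b - c) / 4) \<in> \<rat>"
    "Im ((a + d) / 2) \<in> \<rat>" "Im ((d - a - b - c) / 4) \<in> \<rat>" unfolding gaussian_rats_def by auto
  have "Re ((a + d) / 2) + sqrt 2 * Re ((d - a - b - c) / 4) = 0"
    using arg_cong[OF eq, of Re] by simp
  moreover have "Im ((a + d) / 2) + sqrt 2 * Im ((d - a - b - c) / 4) = 0"
    using arg_cong[OF eq, of Im] by simp
  ultimately have "Re ((a + d) / 2) = 0" "Im ((a + d) / 2) = 0"
    using rat_add_sqrt_2_mult_eq_0 r by blast+
  then have "a + d = 0" by (simp add: complex_eq_iff)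
  then show ?thesis using A by (simp add: trace_def sum_lessThan_2 abcd)
qed

text \<open>Conservation of probability: by cyclicity and idempotence each term is the trace of a
  projector times \<open>A\<close>, and the two projectors add up to the identity.\<close>

lemma trace_measure:
  assumes P: "P \<in> paulis n" and A: "A \<in> carrier_mat (2 ^ n) (2 ^ n)"
  shows "trace (pauli_projector n P 1 * A * pauli_projector n P 1) +
    trace (pauli_projector n P (- 1) * A * pauli_projector n P (- 1)) = trace A"
proof -
  let ?p = "pauli_projector n P"
  note c = pauli_projector_carrier[OF P]
  have *: "trace (?p s * A * ?p s) = trace (?p s * A)" if s: "s \<in> {1, -1}" for s
    using trace_conj[OF c A, of s] pauli_projector_adjoint[OF P s] pauli_projector_idem[OF P s] by simp
  have "trace A = trace ((?p 1 + ?p (- 1)) * A)"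
    using A by (simp add: pauli_projector_add[OF P])
  also have "\<dots> = trace (?p 1 * A + ?p (- 1) * A)"
    by (simp add: add_mult_distrib_mat[OF c c A])
  also have "\<dots> = trace (?p 1 * A) + trace (?p (- 1) * A)"
    using carrier_matD[OF c[of 1]] carrier_matD[OF c[of "-1"]] A 
    by (simp add: trace_def sum.distrib)
  finally show ?thesis using *[of 1] *[of "-1"] by simp
qed

lemma add_nonneg_eq_0_complex:
  fixes x y :: complex
  shows "0 \<le> x \<Longrightarrow> 0 \<le> y \<Longrightarrow> x + y = 0 \<Longrightarrow> x = 0 \<and> y = 0"
  by (auto simp: less_eq_complex_def complex_eq_iff)

text \<open>An output that is orthogonal to \<^const>\<open>ket_H1\<close> in total is orthogonal to it in every branch,
  because the contributions of the branches are nonnegative. So it suffices to follow the branches,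
  and along a branch the state stays Gaussian rational.\<close>

lemma gaussian_input_trace_eq_0:
  assumes "clifford_protocol n m E" "m = 1" "psd (2 ^ n) A" "gaussian_mat A" "quad_form (E A) ket_H1 = 0"
  shows "trace A = 0"
  using assms
proof (induction arbitrary: A rule: clifford_protocol.induct)
  case (finish n)
  then show ?case using trace_eq_0_if_quad_form_ket_H1_eq_0[of A] psd_carrier[of 2 A] by simp
next
  case (unitary C n m E)
  note C = clifford_group_carrier[OF unitary(1)]
  note A = psd_carrier[OF unitary.prems(2)]
  have "trace (C * A * mat_adjoint C) = 0"
    using unitary.prems unitary.hyps A C by (intro unitary.IH psd_conj gaussian_mat_clifford_conj) auto
  moreover have "trace (C * A * mat_adjoint C) = trace A"
    using unitary.hyps(1) by (intro trace_conj_isometry[OF C A]) (auto simp: clifford_group_def unitary_mat_def)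
  ultimately show ?case by simp
next
  case (prepare k \<sigma> n m E)
  note A = psd_carrier[OF prepare.prems(2)]
  obtain K p v where pv: "\<And>l. l < K \<Longrightarrow> 0 \<le> p l" "\<And>l. l < K \<Longrightarrow> pure_stabilizer k (v l)"
    "(\<Sum>l<K. p l) = 1" "\<sigma> = mixture k p v K"
    using prepare.hyps(1) by (rule stabilizer_stateE) blast
  note vc = pure_stabilizer_carrier[OF pv(2)]
  have w: "ket_H1 \<in> carrier_vec (2 ^ m)" using prepare.prems by simp
  let ?q = "\<lambda>l. quad_form (E (tensor_mat A (proj (v l)))) ket_H1"
  have psd: "psd (2 ^ (n + k)) (tensor_mat A (proj (v l)))" if "l < K" for l
    using psd_tensor_proj[OF prepare.prems(2) vc[OF that]] by (simp add: power_add)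
  have q: "0 \<le> ?q l" if "l < K" for l
    using clifford_protocol_psd[OF prepare.hyps(2) psd[OF that]] w unfolding psd_def by blast
  have "(\<Sum>l<K. complex_of_real (p l) * ?q l) = 0"
    using quad_form_protocol_mixture[OF prepare.hyps(2) A vc w, where p = p] prepare.prems(4) pv(4) by simp
  moreover have "0 \<le> complex_of_real (p l) * ?q l" if "l < K" for l
    using q[OF that] pv(1)[OF that] by (simp add: less_eq_complex_def)
  ultimately have z: "complex_of_real (p l) * ?q l = 0" if "l < K" for l
    using that by (subst (asm) sum_nonneg_eq_0_iff) auto
  \<comment> \<open>One component of nonzero weight is enough, because appending it preserves the
    trace of \<open>A\<close>.\<close>
  have "\<exists>l<K. p l \<noteq> 0"
  proof (rule ccontr)
    assume "\<not> (\<exists>l<K. p l \<noteq> 0)"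
    then have "(\<Sum>l<K. p l) = 0" by (intro sum.neutral) auto
    then show False using pv(3) by simp
  qed
  then obtain l where l: "l < K" "p l \<noteq> 0" by blast
  then have "?q l = 0" using z[of l] by simp
  then have "trace (tensor_mat A (proj (v l))) = 0"
    using prepare.prems pv(2)[OF l(1)]
    by (intro prepare.IH psd[OF l(1)] gaussian_mat_tensor gaussian_mat_proj_pure_stabilizer) auto
  then show ?case
    using trace_tensor_proj[OF A vc[OF l(1)] pure_stabilizer_normalized[OF pv(2)[OF l(1)]]] by simp
next
  case (discard n m E k)
  note A = psd_carrier[OF discard.prems(2)]
  have "trace (partial_trace n k A) = 0"
    using discard.prems A by (intro discard.IH psd_partial_trace gaussian_mat_partial_trace) auto
  then show ?case using trace_partial_trace[OF A] by simp
next
  case (measure P n m E1 E2)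
  note A = psd_carrier[OF measure.prems(2)] and P = measure.hyps(1)
  let ?p = "\<lambda>s. pauli_projector n P s * A * pauli_projector n P s"
  note c = pauli_projector_carrier[OF P]
  have w: "ket_H1 \<in> carrier_vec (2 ^ m)" using measure.prems by simp
  have psd: "psd (2 ^ n) (?p s)" if "s \<in> {1, -1}" for s
    by (rule psd_pauli_projector_conj[OF P that measure.prems(2)])
  have gauss: "gaussian_mat (?p s)" if "s \<in> {1, -1}" for s
    using gaussian_mat_pauli_projector[OF P that] measure.prems(3)
    by (intro gaussian_mat_mult[OF mult_carrier_mat[OF c A] c] gaussian_mat_mult[OF c A])
  have psdE: "psd (2 ^ m) (E1 (?p 1))" "psd (2 ^ m) (E2 (?p (- 1)))"
    using clifford_protocol_psd measure.hyps(2,3) psd by blast+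
  have "quad_form (E1 (?p 1)) ket_H1 + quad_form (E2 (?p (- 1))) ket_H1 = 0"
    using measure.prems(4) quad_form_add[OF psdE[THEN psd_carrier] w] by simp
  then have "quad_form (E1 (?p 1)) ket_H1 = 0 \<and> quad_form (E2 (?p (- 1))) ket_H1 = 0"
    using psdE w unfolding psd_def by (intro add_nonneg_eq_0_complex) auto
  \<comment> \<open>Both outcomes have to be followed here, since the trace of \<open>A\<close> is
    distributed over them.\<close>
  then have "trace (?p 1) = 0" "trace (?p (- 1)) = 0"
    using measure.IH(1)[OF measure.prems(1) psd gauss] measure.IH(2)[OF measure.prems(1) psd gauss] by auto
  then show ?case using trace_measure[OF P A] by simp
next
  case (randomize p n m E1 E2)
  have w: "ket_H1 \<in> carrier_vec (2 ^ m)" using randomize.prems by simp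
  have psdE: "psd (2 ^ m) (E1 A)" "psd (2 ^ m) (E2 A)"
    using clifford_protocol_psd randomize.hyps(3,4) randomize.prems(2) by blast+
  note cE = psdE[THEN psd_carrier]
  have "complex_of_real p * quad_form (E1 A) ket_H1 + complex_of_real (1 - p) * quad_form (E2 A) ket_H1 = 0"
    using randomize.prems(4) cE w by (simp add: quad_form_add[of _ "2^m"] quad_form_smult[of _ "2^m"])
  then have "complex_of_real p * quad_form (E1 A) ket_H1 = 0 \<and> complex_of_real (1 - p) * quad_form (E2 A) ket_H1 = 0"
    using psdE w randomize.hyps(1,2) unfolding psd_def 
    by (intro add_nonneg_eq_0_complex) (auto simp: less_eq_complex_def)
  \<comment> \<open>The weights \<open>p\<close> and \<open>1 - p\<close> do not both vanish. One
    branch suffices, because either continuation receives \<open>A\<close> itself.\<close>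
  then have "quad_form (E1 A) ket_H1 = 0 \<or> quad_form (E2 A) ket_H1 = 0" by auto
  then show ?case using randomize.IH randomize.prems by blast
qed

section \<open>The amplitudes of \<open>ket_phi\<close>\<close>

lemma cscalar_prod_2:
  fixes v w :: "complex vec"
  assumes "v \<in> carrier_vec 2" "w \<in> carrier_vec 2"
  shows "v \<bullet>c w = v $ 0 * cnj (w $ 0) + v $ Suc 0 * cnj (w $ Suc 0)"
  unfolding cscalar_prod_sum[OF assms] by (simp add: sum_lessThan_2)

lemma ket_H_orthonormal:
  "ket_H0 \<bullet>c ket_H0 = 1" "ket_H1 \<bullet>c ket_H1 = 1" "ket_H0 \<bullet>c ket_H1 = 0" "ket_H1 \<bullet>c ket_H0 = 0"
proof -
  have "complex_of_real (cos (pi / 8) ^ 2 + sin (pi / 8) ^ 2) = 1" by simp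
  then have "complex_of_real (cos (pi / 8)) * complex_of_real (cos (pi / 8)) + 
      complex_of_real (sin (pi / 8)) * complex_of_real (sin (pi / 8)) = 1"
    by (simp only: of_real_add of_real_mult power2_eq_square)
  then show "ket_H0 \<bullet>c ket_H0 = 1" "ket_H1 \<bullet>c ket_H1 = 1" "ket_H0 \<bullet>c ket_H1 = 0" "ket_H1 \<bullet>c ket_H0 = 0"
    by (simp_all add: cscalar_prod_2 algebra_simps)
qed

lemma cscalar_prod_tensor_vec:
  assumes "v \<in> carrier_vec n" "v' \<in> carrier_vec n" "w \<in> carrier_vec m" "w' \<in> carrier_vec m"
  shows "tensor_vec v w \<bullet>c tensor_vec v' w' = (v \<bullet>c v') * (w \<bullet>c w')"
proof -
  have "tensor_vec v w \<bullet>c tensor_vec v' w' = (\<Sum>i<n * m. tensor_vec v w $ i * cnj (tensor_vec v' w' $ i))"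
    using assms by (intro cscalar_prod_sum tensor_vec_carrier)
  also have "\<dots> = (\<Sum>i<n. \<Sum>j<m. (v $ i * cnj (v' $ i)) * (w $ j * cnj (w' $ j)))"
    unfolding sum_lessThan_mult using assms by (intro sum.cong refl) (auto simp: mult_add_less)
  also have "\<dots> = (v \<bullet>c v') * (w \<bullet>c w')"
    using assms by (simp add: cscalar_prod_sum sum_product)
  finally show ?thesis .
qed

text \<open>A GHZ state in the eigenbasis of H, before normalisation.\<close>

definition ghz :: "complex vec" where
  "ghz = tensor_vec ket_H0 (tensor_vec ket_H0 ket_H0) + tensor_vec ket_H1 (tensor_vec ket_H1 ket_H1)"

lemma ghz_carrier [simp]: "ghz \<in> carrier_vec 8"
proof -
  have "tensor_vec v (tensor_vec v v) \<in> carrier_vec (2 * (2 * 2))" if "v \<in> carrier_vec 2" for v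
    using that by (intro tensor_vec_carrier)
  then show ?thesis by (simp add: ghz_def)
qed

lemma ghz_cscalar_prod: "ghz \<bullet>c ghz = 2"
proof -
  let ?t = "\<lambda>v. tensor_vec v (tensor_vec v v)"
  have t: "?t v \<in> carrier_vec (2 * (2 * 2))" if "v \<in> carrier_vec 2" for v
    using that by (intro tensor_vec_carrier)
  have ip: "?t v \<bullet>c ?t w = (v \<bullet>c w) * ((v \<bullet>c w) * (v \<bullet>c w))" if "v \<in> carrier_vec 2" "w \<in> carrier_vec 2" for v w
    using that by (simp add: cscalar_prod_tensor_vec[of _ 2 _ _ "2 * 2"] cscalar_prod_tensor_vec[of _ 2 _ _ 2] tensor_vec_carrier[of _ 2 _ 2, simplified])
  have add: "(x + y) \<bullet>c (x + y) = x \<bullet>c x + x \<bullet>c y + (y \<bullet>c x + y \<bullet>c y)"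
    if "x \<in> carrier_vec (2 * (2 * 2))" "y \<in> carrier_vec (2 * (2 * 2))" for x y :: "complex vec"
    using that by (simp add: cscalar_prod_sum[of _ 8] sum.distrib algebra_simps)
  have "ghz \<bullet>c ghz = ?t ket_H0 \<bullet>c ?t ket_H0 + ?t ket_H0 \<bullet>c ?t ket_H1 + (?t ket_H1 \<bullet>c ?t ket_H0 + ?t ket_H1 \<bullet>c ?t ket_H1)"
    unfolding ghz_def by (rule add[OF t[OF ket_H0_carrier] t[OF ket_H1_carrier]])
  then show ?thesis by (simp add: ip ket_H_orthonormal)
qed

lemma ket_phi_ghz: "ket_phi = complex_of_real (1 / sqrt 2) \<cdot>\<^sub>v ghz"
  unfolding ket_phi_def normalize_vec_def ghz_def[symmetric] ghz_cscalar_prod by simp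

lemma ket_phi_carrier [simp]: "ket_phi \<in> carrier_vec 8"
  by (simp add: ket_phi_ghz)

text \<open>Since \<open>c - \<i> s\<close> is a phase and \<open>c s = \<surd>2 / 4\<close>, the list contains the amplitudes of
  \<^const>\<open>ket_phi\<close> up to a global phase and a rational factor.\<close>

lemma ghz_gaussian:
  fixes c s :: complex
  defines "c \<equiv> complex_of_real (cos (pi / 8))" and "s \<equiv> complex_of_real (sin (pi / 8))"
  assumes k: "k < 8"
  shows "ghz $ k = c * s * (c - \<i> * s) * ([2 + \<i>, 1, 1, \<i>, 1, \<i>, \<i>, 1 - 2 * \<i>] ! k)"
proof -
  have sq: "c * c = 2 * c * s + s * s"
    using complex_cos_pi_8_square by (simp add: c_def s_def mult.assoc)
  have sq': "s * s = c * c - 2 * c * s" using sq by simp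
  \<comment> \<open>The amplitudes are homogeneous cubics in \<open>c\<close> and \<open>s\<close>.
    Once the two cubes are eliminated, only the monomials c^2 s and c s^2 remain, and coefficients
    can be compared.\<close>
  have "c * (c * c) = c * (2 * c * s + s * s)" unfolding sq ..
  then have c3: "c * (c * c) = 2 * (c * (c * s)) + c * (s * s)" by (simp add: algebra_simps)
  have "s * (s * s) = s * (c * c - 2 * c * s)" unfolding sq' ..
  then have s3: "s * (s * s) = c * (c * s) + - 2 * (c * (s * s))" by (simp add: algebra_simps)
  have "k \<in> {0, 1, 2, 3, 4, 5, 6, 7}" using k by auto
  then show ?thesis
    unfolding ghz_def
    by (elim insertE emptyE; simp add: c_def[symmetric] s_def[symmetric] c3 s3 algebra_simps)
qed

lemma gaussian_mat_proj_ket_phi: "gaussian_mat (proj ket_phi)"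
  unfolding gaussian_mat_def
proof (intro allI impI)
  let ?c = "complex_of_real (cos (pi / 8))" and ?s = "complex_of_real (sin (pi / 8))"
  let ?g = "[2 + \<i>, 1, 1, \<i>, 1, \<i>, \<i>, 1 - 2 * \<i>]"
  fix i j assume "i < dim_row (proj ket_phi)" "j < dim_col (proj ket_phi)"
  then have ij: "i < 8" "j < 8" by (simp_all add: proj_def carrier_vecD[OF ket_phi_carrier])
  have g: "?g ! k \<in> gaussian_rats" if "k < 8" for k
  proof -
    have "set ?g \<subseteq> gaussian_rats" by auto
    then show ?thesis using nth_mem[of k ?g] that by auto
  qed
  \<comment> \<open>The phase cancels in the projector, and the remaining common factors are
    rational: 1/8 from (c s)^2 and 1/2 from the normalisation, together 1/16.\<close>
  have n: "(?c - \<i> * ?s) * cnj (?c - \<i> * ?s) = 1"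
    by (simp add: complex_eq_iff power2_eq_square[symmetric])
  have m: "?c * ?s * cnj (?c * ?s) = 1 / 8"
  proof -
    have "?c * ?s = complex_of_real (sqrt 2 / 4)" using cos_sin_pi_8(3) by (simp only: of_real_mult[symmetric])
    then show ?thesis by (simp only: complex_cnj_complex_of_real of_real_mult[symmetric]) (simp add: field_simps)
  qed
  have h: "complex_of_real (1 / sqrt 2) * complex_of_real (1 / sqrt 2) = 1 / 2"
    unfolding of_real_mult[symmetric] by (simp add: field_simps)
  have "proj ket_phi $$ (i, j) = complex_of_real (1 / sqrt 2) * ghz $ i * cnj (complex_of_real (1 / sqrt 2) * ghz $ j)"
    using ij by (simp add: ket_phi_ghz carrier_vecD[OF ghz_carrier])
  also have "\<dots> = (complex_of_real (1 / sqrt 2) * complex_of_real (1 / sqrt 2)) * (?c * ?s * cnj (?c * ?s)) 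
      * ((?c - \<i> * ?s) * cnj (?c - \<i> * ?s)) * (?g ! i * cnj (?g ! j))"
    unfolding ghz_gaussian[OF ij(1)] ghz_gaussian[OF ij(2)] complex_cnj_mult complex_cnj_complex_of_real
    by (simp only: mult_ac)
  also have "\<dots> = ?g ! i * cnj (?g ! j) / 16"
    unfolding n m h by simp
  also have "\<dots> \<in> gaussian_rats" using g[OF ij(1)] g[OF ij(2)] by (intro gaussian_rats_intros(7,8,10))
  finally show "proj ket_phi $$ (i, j) \<in> gaussian_rats" .
qed

lemma trace_proj: "v \<in> carrier_vec n \<Longrightarrow> trace (proj v) = v \<bullet>c v"
  by (simp add: trace_def cscalar_prod_sum proj_def)

lemma psd_proj:
  assumes v: "v \<in> carrier_vec n"
  shows "psd n (proj v)"
  unfolding psd_def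
proof (intro conjI ballI)
  fix u :: "complex vec" assume u: "u \<in> carrier_vec n"
  have "v \<bullet>c u = cnj (u \<bullet>c v)" using u v by (simp add: cscalar_prod_sum mult.commute)
  then have "quad_form (proj v) u = (u \<bullet>c v) * cnj (u \<bullet>c v)"
    using u v by (simp add: quad_form_def proj_mult_vec)
  then show "0 \<le> quad_form (proj v) u"
    by (simp add: less_eq_complex_def)
qed (use v in auto)

text \<open>A deterministic conversion would make the output orthogonal to \<open>ket_H1\<close>,
  hence the trace of the input zero, whereas the trace of a normalized pure state is 1.\<close>

lemma ket_phi_not_convertible: "\<not> det_converts 3 1 (proj ket_phi) (proj ket_H0)"
proof
  assume "det_converts 3 1 (proj ket_phi) (proj ket_H0)"
  then obtain E where E: "clifford_protocol 3 1 E" "E (proj ket_phi) = proj ket_H0"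
    unfolding det_converts_def by blast
  have "quad_form (proj ket_H0) ket_H1 = 0"
    by (simp add: quad_form_def proj_mult_vec[of _ 2] ket_H_orthonormal)
  moreover have "psd (2 ^ 3) (proj ket_phi)" by (simp add: psd_proj)
  ultimately have "trace (proj ket_phi) = 0"
    using gaussian_input_trace_eq_0[OF E(1)] E(2) gaussian_mat_proj_ket_phi by auto
  moreover have "trace (proj ket_phi) = complex_of_real (1 / sqrt 2) * complex_of_real (1 / sqrt 2) * (ghz \<bullet>c ghz)"
    unfolding trace_proj[OF ket_phi_carrier] unfolding ket_phi_ghz
    by (simp add: cscalar_prod_sum[of _ 8] carrier_vecD[OF ghz_carrier] sum_distrib_left mult_ac)
  ultimately show False by (simp add: ghz_cscalar_prod)
qed

section \<open>Conversion with a catalyst\<close>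

lemma tensor_vec_add_left: "dim_vec v = dim_vec w \<Longrightarrow> tensor_vec (v + w) x = tensor_vec v x + tensor_vec w x"
  by (intro eq_vecI) (auto simp: less_mult_div_mod distrib_left distrib_right)

lemma tensor_vec_smult_left: "tensor_vec (c \<cdot>\<^sub>v v) w = c \<cdot>\<^sub>v tensor_vec v w"
  by (intro eq_vecI) (auto simp: less_mult_div_mod)

lemma tensor_vec_smult_right: "tensor_vec v (c \<cdot>\<^sub>v w) = c \<cdot>\<^sub>v tensor_vec v w"
  by (intro eq_vecI) (auto simp: less_mult_div_mod)

lemma vec_4_eqI:
  assumes "v \<in> carrier_vec 4" "w \<in> carrier_vec 4" 
    "v $ 0 = w $ 0" "v $ 1 = w $ 1" "v $ 2 = w $ 2" "v $ 3 = w $ 3"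
  shows "v = w"
proof (rule eq_vecI)
  fix i assume "i < dim_vec w"
  then have "i \<in> {0, 1, 2, 3}" using assms by auto
  then show "v $ i = w $ i" using assms by auto
qed (use assms in auto)

lemma vec_2_eqI:
  assumes "v \<in> carrier_vec 2" "w \<in> carrier_vec 2" "v $ 0 = w $ 0" "v $ Suc 0 = w $ Suc 0"
  shows "v = w"
proof (rule eq_vecI)
  fix i assume "i < dim_vec w"
  then have "i = 0 \<or> i = Suc 0" using assms by auto
  then show "v $ i = w $ i" using assms by auto
qed (use assms in auto)

lemma mult_mat_vec_2_index:
  assumes "A \<in> carrier_mat 2 2" "v \<in> carrier_vec 2" "i < 2"
  shows "(A *\<^sub>v v) $ i = A $$ (i, 0) * v $ 0 + A $$ (i, Suc 0) * v $ Suc 0"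
  unfolding mult_mat_vec_index_sum[OF assms] by (rule sum_lessThan_2)

lemma pauli_Y_mult_ket_H0: "pauli_Y *\<^sub>v ket_H0 = ket_H1"
  by (simp add: ket_H1_def)

lemma pauli_Y_mult_ket_H1: "pauli_Y *\<^sub>v ket_H1 = ket_H0"
proof (rule vec_2_eqI)
  show "pauli_Y *\<^sub>v ket_H1 \<in> carrier_vec 2" by (rule mult_mat_vec_carrier[of _ 2 2]) auto
qed (simp_all add: mult_mat_vec_2_index del: index_mult_mat_vec)

lemma pauli_projector_tensor_one_left:
  assumes "P \<in> carrier_mat (2 ^ m) (2 ^ m)"
  shows "pauli_projector (n + m) (tensor_mat (1\<^sub>m (2 ^ n)) P) s = tensor_mat (1\<^sub>m (2 ^ n)) (pauli_projector m P s)"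
  using assms unfolding pauli_projector_def tensor_mat_smult_right
  by (subst tensor_mat_add_right[of _ "2^m" "2^m"]) (auto simp: tensor_mat_one_one tensor_mat_smult_right power_add)

lemma proj_smult: "proj (c \<cdot>\<^sub>v v) = (c * cnj c) \<cdot>\<^sub>m proj v"
  by (intro eq_matI) (auto simp: proj_def)

lemma partial_trace_proj_tensor_vec:
  assumes x: "x \<in> carrier_vec (2 ^ n)" and y: "y \<in> carrier_vec (2 ^ k)"
  shows "partial_trace n k (proj (tensor_vec x y)) = (y \<bullet>c y) \<cdot>\<^sub>m proj x"
proof (rule eq_matI)
  fix i j assume "i < dim_row ((y \<bullet>c y) \<cdot>\<^sub>m proj x)" "j < dim_col ((y \<bullet>c y) \<cdot>\<^sub>m proj x)"
  then have ij: "i < 2 ^ n" "j < 2 ^ n" using x by (auto simp: proj_def)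
  have "partial_trace n k (proj (tensor_vec x y)) $$ (i, j) = 
      (\<Sum>l<2^k. proj (tensor_vec x y) $$ (i * 2 ^ k + l, j * 2 ^ k + l))"
    using ij by (simp add: partial_trace_def)
  also have "\<dots> = (\<Sum>l<2^k. (y $ l * cnj (y $ l)) * (x $ i * cnj (x $ j)))"
    using ij x y by (intro sum.cong refl) (simp add: mult_add_less)
  also have "\<dots> = ((y \<bullet>c y) \<cdot>\<^sub>m proj x) $$ (i, j)"
    using ij carrier_matD[OF proj_carrier[OF x]] x by (simp add: cscalar_prod_sum[OF y y] sum_distrib_right)
  finally show "partial_trace n k (proj (tensor_vec x y)) $$ (i, j) = ((y \<bullet>c y) \<cdot>\<^sub>m proj x) $$ (i, j)" .
qed (use x in \<open>auto simp: partial_trace_def proj_def\<close>)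

lemma tensor_vec_carrier_4 [simp]:
  "v \<in> carrier_vec 2 \<Longrightarrow> w \<in> carrier_vec 2 \<Longrightarrow> tensor_vec v w \<in> carrier_vec 4"
  using tensor_vec_carrier[of v 2 w 2] by simp

section \<open>Pauli measurements on pairs of qubits\<close>

definition YY :: "complex mat" where
  "YY = tensor_mat pauli_Y pauli_Y"

lemma tensor_qubit_paulis: "P \<in> qubit_paulis \<Longrightarrow> Q \<in> qubit_paulis \<Longrightarrow> tensor_mat P Q \<in> paulis 2"
  using paulis_tensor[OF qubit_paulis_subset qubit_paulis_subset] by (simp add: numeral_2_eq_2)

lemma YY_in_paulis: "YY \<in> paulis 2"
  unfolding YY_def by (rule tensor_qubit_paulis) (simp_all add: qubit_paulis_def)

lemma YY_carrier [simp]: "YY \<in> carrier_mat 4 4"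
  using paulis_carrier[OF YY_in_paulis] by simp

lemma YY_mult_tensor_vec:
  "v \<in> carrier_vec 2 \<Longrightarrow> w \<in> carrier_vec 2 \<Longrightarrow>
   YY *\<^sub>v tensor_vec v w = tensor_vec (pauli_Y *\<^sub>v v) (pauli_Y *\<^sub>v w)"
  unfolding YY_def by (rule tensor_mat_mult_vec[of _ 2 2 _ _ 2 2]) auto

lemma tensor_one_in_paulis: 
  assumes "P \<in> paulis 2"
  shows "tensor_mat (1\<^sub>m 4) P \<in> paulis 4" "tensor_mat P (1\<^sub>m 4) \<in> paulis 4"
  using paulis_tensor[OF one_in_paulis assms, of 2] paulis_tensor[OF assms one_in_paulis, of 2] by simp_all

lemma pauli_projector_tensor_vec:
  assumes "P \<in> paulis 2" "x \<in> carrier_vec 4" "y \<in> carrier_vec 4"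
  shows "pauli_projector 4 (tensor_mat (1\<^sub>m 4) P) s *\<^sub>v tensor_vec x y = tensor_vec x (pauli_projector 2 P s *\<^sub>v y)"
proof -
  have eq: "pauli_projector 4 (tensor_mat (1\<^sub>m 4) P) s = tensor_mat (1\<^sub>m 4) (pauli_projector 2 P s)"
    using pauli_projector_tensor_one_left[OF paulis_carrier[OF assms(1)], of 2 s] by simp
  have c: "pauli_projector 2 P s \<in> carrier_mat 4 4"
    using pauli_projector_carrier[OF assms(1)] by simp
  show ?thesis
    unfolding eq tensor_mat_mult_vec[OF one_carrier_mat assms(2) c assms(3)] using assms(2) by simp
qed

lemma pauli_projector_conj_proj:
  assumes "P \<in> paulis n" "s \<in> {1, -1}" "v \<in> carrier_vec (2 ^ n)"
  shows "pauli_projector n P s * proj v * pauli_projector n P s = proj (pauli_projector n P s *\<^sub>v v)"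
  using conj_proj[OF pauli_projector_carrier[OF assms(1)] assms(3), of s] pauli_projector_adjoint[OF assms(1,2)]
  by simp

text \<open>The tail shared by both outcomes of the first measurement. The outcome of
  \<open>M\<close> on the last pair is meant to reveal the first pair: for -1 it holds two copies of
  \<open>ket_H1\<close>, which \<open>C\<close> turns into copies of \<open>ket_H0\<close>.\<close>

definition decode :: "complex mat \<Rightarrow> complex mat \<Rightarrow> complex mat" where
  "decode M \<rho> = (let p = pauli_projector 4 (tensor_mat (1\<^sub>m 4) M); C = tensor_mat YY (1\<^sub>m 4) in
     partial_trace 2 2 (p 1 * \<rho> * p 1) +
     partial_trace 2 2 (C * (p (- 1) * \<rho> * p (- 1)) * mat_adjoint C))"

lemma clifford_protocol_decode:
  assumes "M \<in> paulis 2"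
  shows "clifford_protocol 4 2 (decode M)"
proof -
  have d: "clifford_protocol 4 2 (partial_trace 2 2)"
    using clifford_protocol.discard[OF clifford_protocol.finish, of 2 2] by simp
  have C: "tensor_mat YY (1\<^sub>m 4) \<in> clifford_group 4"
    using tensor_one_in_paulis(2)[OF YY_in_paulis] paulis_subset_clifford_group by blast
  show ?thesis
    using clifford_protocol.measure[OF tensor_one_in_paulis(1)[OF assms] d clifford_protocol.unitary[OF C d]]
    unfolding decode_def[abs_def] Let_def .
qed

text \<open>The eigenvalues of \<open>M\<close> separate the two terms, so either outcome leaves a
  product vector. After the correction the first pair is the same for both outcomes, and discarding
  the second pair only contributes its squared norm, which is the weight of that outcome.\<close>

lemma decode_proj:
  assumes M: "M \<in> paulis 2" and b: "\<beta> \<in> carrier_vec 4" and c: "\<gamma> \<in> carrier_vec 4"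
    and Mb: "M *\<^sub>v \<beta> = \<beta>" and Mc: "M *\<^sub>v \<gamma> = - 1 \<cdot>\<^sub>v \<gamma>"
  shows "decode M (proj (k \<cdot>\<^sub>v (tensor_vec (tensor_vec ket_H0 ket_H0) \<beta> + tensor_vec (tensor_vec ket_H1 ket_H1) \<gamma>))) =
    (k * cnj k * (\<beta> \<bullet>c \<beta> + \<gamma> \<bullet>c \<gamma>)) \<cdot>\<^sub>m proj (tensor_vec ket_H0 ket_H0)"
proof -
  let ?aa = "tensor_vec ket_H0 ket_H0" and ?bb = "tensor_vec ket_H1 ket_H1"
  let ?x = "tensor_vec ?aa \<beta> + tensor_vec ?bb \<gamma>"
  let ?p = "pauli_projector 4 (tensor_mat (1\<^sub>m 4) M)" and ?C = "tensor_mat YY (1\<^sub>m 4)"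
  note M1 = tensor_one_in_paulis(1)[OF M]
  have tc: "tensor_vec v w \<in> carrier_vec 16" if "v \<in> carrier_vec 4" "w \<in> carrier_vec 4" for v w
    using tensor_vec_carrier[OF that] by simp
  have aac: "?aa \<in> carrier_vec 4" "?bb \<in> carrier_vec 4" by auto
  have pc: "?p s \<in> carrier_mat 16 16" for s using pauli_projector_carrier[OF M1] by simp
  have Cc: "?C \<in> carrier_mat 16 16" using tensor_mat_carrier[OF YY_carrier one_carrier_mat, of 4] by simp
  have pb: "pauli_projector 2 M s *\<^sub>v \<beta> = ((1 + s) / 2) \<cdot>\<^sub>v \<beta>" for s
    using pauli_projector_mult_eigenvector[OF M, of \<beta> 1 s] b Mb by simp
  have pg: "pauli_projector 2 M s *\<^sub>v \<gamma> = ((1 - s) / 2) \<cdot>\<^sub>v \<gamma>" for s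
    using pauli_projector_mult_eigenvector[OF M, of \<gamma> "-1" s] c Mc by simp
  have x: "?x \<in> carrier_vec 16" using aac b c by (intro add_carrier_vec tc)
  have px: "?p s *\<^sub>v (k \<cdot>\<^sub>v ?x) = k \<cdot>\<^sub>v (((1 + s) / 2) \<cdot>\<^sub>v tensor_vec ?aa \<beta> + ((1 - s) / 2) \<cdot>\<^sub>v tensor_vec ?bb \<gamma>)" for s
    unfolding mult_mat_vec[OF pc x] mult_add_distrib_mat_vec[OF pc tc[OF aac(1) b] tc[OF aac(2) c]]
      pauli_projector_tensor_vec[OF M aac(1) b] pauli_projector_tensor_vec[OF M aac(2) c] pb pg tensor_vec_smult_right ..
  \<comment> \<open>The coefficients (1 + s) / 2 and (1 - s) / 2 are 1 and 0 for this outcome and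
    are exchanged for the other one.\<close>
  have p1: "?p 1 *\<^sub>v (k \<cdot>\<^sub>v ?x) = k \<cdot>\<^sub>v tensor_vec ?aa \<beta>"
    unfolding px by (intro eq_vecI) (auto simp: carrier_vecD[OF b] carrier_vecD[OF c])
  have p2: "?p (- 1) *\<^sub>v (k \<cdot>\<^sub>v ?x) = k \<cdot>\<^sub>v tensor_vec ?bb \<gamma>"
    unfolding px by (intro eq_vecI) (auto simp: carrier_vecD[OF b] carrier_vecD[OF c])
  have "YY *\<^sub>v ?bb = ?aa" by (simp add: YY_mult_tensor_vec pauli_Y_mult_ket_H1)
  then have Cx: "?C *\<^sub>v (k \<cdot>\<^sub>v tensor_vec ?bb \<gamma>) = k \<cdot>\<^sub>v tensor_vec ?aa \<gamma>"
    using mult_mat_vec[OF Cc tc[OF aac(2) c]] tensor_mat_mult_vec[OF YY_carrier aac(2) one_carrier_mat c] c by simp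
  have cc: "proj (k \<cdot>\<^sub>v ?x) \<in> carrier_mat 16 16" using x by simp
  have m: "?p s * proj (k \<cdot>\<^sub>v ?x) * ?p s = proj (?p s *\<^sub>v (k \<cdot>\<^sub>v ?x))" if "s \<in> {1, -1}" for s
    using pauli_projector_conj_proj[OF M1 that, of "k \<cdot>\<^sub>v ?x"] x by simp
  have pt: "partial_trace 2 2 (proj (k \<cdot>\<^sub>v tensor_vec ?aa y)) = (k * cnj k * (y \<bullet>c y)) \<cdot>\<^sub>m proj ?aa"
    if "y \<in> carrier_vec 4" for y
  proof -
    have "proj (tensor_vec ?aa y) \<in> carrier_mat (2 ^ (2 + 2)) (2 ^ (2 + 2))" using tc[OF aac(1) that] by simp
    then show ?thesis
      unfolding proj_smult using partial_trace_proj_tensor_vec[of ?aa 2 y 2] that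
      by (simp add: partial_trace_smult)
  qed
  have "decode M (proj (k \<cdot>\<^sub>v ?x)) = partial_trace 2 2 (proj (k \<cdot>\<^sub>v tensor_vec ?aa \<beta>)) + 
      partial_trace 2 2 (proj (k \<cdot>\<^sub>v tensor_vec ?aa \<gamma>))"
    unfolding decode_def Let_def using m[of 1] m[of "-1"] conj_proj[OF Cc, of "k \<cdot>\<^sub>v tensor_vec ?bb \<gamma>"] tc[OF aac(2) c]
    by (simp add: p1 p2 Cx)
  also have "\<dots> = (k * cnj k * (\<beta> \<bullet>c \<beta> + \<gamma> \<bullet>c \<gamma>)) \<cdot>\<^sub>m proj ?aa"
    unfolding pt[OF b] pt[OF c] by (intro eq_matI) (auto simp: algebra_simps)
  finally show ?thesis .
qed

lemma tensor_qubit_mult_vec_index: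
  assumes "A \<in> carrier_mat 2 2" "B \<in> carrier_mat 2 2" "v \<in> carrier_vec 4" "i < 4"
  shows "(tensor_mat A B *\<^sub>v v) $ i = 
    A $$ (i div 2, 0) * (B $$ (i mod 2, 0) * v $ 0 + B $$ (i mod 2, 1) * v $ 1) +
    A $$ (i div 2, 1) * (B $$ (i mod 2, 0) * v $ 2 + B $$ (i mod 2, 1) * v $ 3)"
proof -
  have "tensor_mat A B \<in> carrier_mat 4 4" using tensor_mat_carrier[OF assms(1,2)] by simp
  note ix = mult_mat_vec_index_sum[OF this assms(3,4)]
  have v: "v $ 2 = v $ Suc (Suc 0)" "v $ 3 = v $ Suc (Suc (Suc 0))"
    by (simp_all add: numeral_2_eq_2 numeral_3_eq_3)
  from ix show ?thesis
    using assms sum_lessThan_mult[of "\<lambda>l. tensor_mat A B $$ (i, l) * v $ l" 2 2]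
    by (simp add: sum_lessThan_2 algebra_simps v)
qed

text \<open>On an eigenspace of \<open>Y \<otimes> Y\<close> the operator \<open>H \<otimes> H\<close> agrees with a Pauli operator:
  with \<open>X \<otimes> Z\<close> for the eigenvalue \<open>1\<close> and with \<open>X \<otimes> X\<close> for the eigenvalue \<open>-1\<close>.\<close>

definition parity_pauli :: "complex \<Rightarrow> complex mat" where
  "parity_pauli t = tensor_mat pauli_X (if t = 1 then pauli_Z else pauli_X)"

lemma parity_pauli_in_paulis: "parity_pauli t \<in> paulis 2"
  unfolding parity_pauli_def by (rule tensor_qubit_paulis) (simp_all add: qubit_paulis_def)

text \<open>For a sign \<open>t\<close>, the unnormalised projection of two copies of
  \<open>ket_H0\<close> onto the eigenspace of \<open>YY\<close> for \<open>t\<close>. The number of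
  factors \<open>ket_H1\<close> is even in both terms, so H H has the value 1; in
  \<open>odd_ket\<close> it is odd and the value is -1.\<close>

definition even_ket :: "complex \<Rightarrow> complex vec" where
  "even_ket t = tensor_vec ket_H0 ket_H0 + t \<cdot>\<^sub>v tensor_vec ket_H1 ket_H1"

definition odd_ket :: "complex \<Rightarrow> complex vec" where
  "odd_ket t = tensor_vec ket_H1 ket_H0 + t \<cdot>\<^sub>v tensor_vec ket_H0 ket_H1"

lemma even_odd_ket_carrier [simp]: "even_ket t \<in> carrier_vec 4" "odd_ket t \<in> carrier_vec 4"
  by (auto simp: even_ket_def odd_ket_def)

text \<open>From Z X = (Y Y) (X Z) and Z Z = - (Y Y) (X X) one gets H H = ((1 + Y Y) (X Z) + (1 - Y
  Y) (X X)) / 2. On the eigenspace of \<open>YY\<close> for \<open>t\<close> this is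
  \<open>parity_pauli t\<close>. The proof checks the four entries.\<close>

lemma parity_pauli_mult_even_ket:
  assumes "t \<in> {1, -1}"
  shows "parity_pauli t *\<^sub>v even_ket t = even_ket t"
proof (rule vec_4_eqI)
  have c: "parity_pauli t \<in> carrier_mat 4 4" using paulis_carrier[OF parity_pauli_in_paulis] by simp
  then show "parity_pauli t *\<^sub>v even_ket t \<in> carrier_vec 4" by (rule mult_mat_vec_carrier) simp
qed (use assms in \<open>auto simp: parity_pauli_def tensor_qubit_mult_vec_index even_ket_def algebra_simps complex_cos_pi_8_square 
   simp del: index_mult_mat_vec\<close>)

lemma parity_pauli_mult_odd_ket:
  assumes "t \<in> {1, -1}"
  shows "parity_pauli t *\<^sub>v odd_ket t = - 1 \<cdot>\<^sub>v odd_ket t"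
proof (rule vec_4_eqI)
  have c: "parity_pauli t \<in> carrier_mat 4 4" using paulis_carrier[OF parity_pauli_in_paulis] by simp
  then show "parity_pauli t *\<^sub>v odd_ket t \<in> carrier_vec 4" by (rule mult_mat_vec_carrier) simp
qed (use assms in \<open>auto simp: parity_pauli_def tensor_qubit_mult_vec_index odd_ket_def algebra_simps complex_cos_pi_8_square
   simp del: index_mult_mat_vec\<close>)

lemma cscalar_prod_even_odd_ket:
  assumes "t \<in> {1, -1}"
  shows "even_ket t \<bullet>c even_ket t = 2" "odd_ket t \<bullet>c odd_ket t = 2"
proof -
  have add: "(x + t \<cdot>\<^sub>v y) \<bullet>c (x + t \<cdot>\<^sub>v y) = x \<bullet>c x + t * (x \<bullet>c y) + (t * (y \<bullet>c x) + y \<bullet>c y)"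
    if "x \<in> carrier_vec 4" "y \<in> carrier_vec 4" for x y :: "complex vec"
    using that assms by (auto simp: cscalar_prod_sum[of _ 4] sum.distrib algebra_simps sum_negf sum_subtractf)
  show "even_ket t \<bullet>c even_ket t = 2" "odd_ket t \<bullet>c odd_ket t = 2"
    unfolding even_ket_def odd_ket_def
    by (simp_all add: add cscalar_prod_tensor_vec[of _ 2 _ _ 2] ket_H_orthonormal)
qed

lemma YY_projector_mult:
  assumes "t \<in> {1, -1}"
  shows "pauli_projector 2 YY t *\<^sub>v tensor_vec ket_H0 ket_H0 = (1 / 2) \<cdot>\<^sub>v even_ket t"
    "pauli_projector 2 YY t *\<^sub>v tensor_vec ket_H1 ket_H0 = (1 / 2) \<cdot>\<^sub>v odd_ket t"
proof -
  have *: "pauli_projector 2 YY t *\<^sub>v v = (1 / 2) \<cdot>\<^sub>v (v + t \<cdot>\<^sub>v (YY *\<^sub>v v))" if "v \<in> carrier_vec 4" for v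
    using that unfolding pauli_projector_def
    by (simp add: smult_mat_mult_vec[of _ 4 4] add_mult_distrib_mat_vec[of _ 4 4])
  show "pauli_projector 2 YY t *\<^sub>v tensor_vec ket_H0 ket_H0 = (1 / 2) \<cdot>\<^sub>v even_ket t"
    "pauli_projector 2 YY t *\<^sub>v tensor_vec ket_H1 ket_H0 = (1 / 2) \<cdot>\<^sub>v odd_ket t"
    by (simp_all add: * YY_mult_tensor_vec pauli_Y_mult_ket_H0 pauli_Y_mult_ket_H1 even_ket_def odd_ket_def)
qed

text \<open>Grouping the qubits in pairs, with the catalyst next to the third qubit of
  \<open>ket_phi\<close>, gives a sum of two terms: H0 H0 followed by H0 H0, and H1 H1 followed by
  H1 H0. The parity of the second pair thus identifies the first pair.\<close>

lemma ket_phi_catalysis: "det_converts 4 2 (proj (tensor_vec ket_phi ket_H0)) (proj (tensor_vec ket_H0 ket_H0))"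
proof -
  let ?aa = "tensor_vec ket_H0 ket_H0" and ?bb = "tensor_vec ket_H1 ket_H1" and ?ba = "tensor_vec ket_H1 ket_H0"
  let ?r = "complex_of_real (1 / sqrt 2)"
  let ?P = "tensor_mat (1\<^sub>m 4) YY"
  note P = tensor_one_in_paulis(1)[OF YY_in_paulis]
  \<comment> \<open>Feedforward: the outcome of \<open>YY\<close> selects the Pauli operator that
    stands in for H H.\<close>
  let ?E = "\<lambda>\<rho>. decode (parity_pauli 1) (pauli_projector 4 ?P 1 * \<rho> * pauli_projector 4 ?P 1) +
      decode (parity_pauli (- 1)) (pauli_projector 4 ?P (- 1) * \<rho> * pauli_projector 4 ?P (- 1))"
  have E: "clifford_protocol 4 2 ?E"
    by (intro clifford_protocol.measure P clifford_protocol_decode parity_pauli_in_paulis)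
  have aac: "?aa \<in> carrier_vec 4" "?bb \<in> carrier_vec 4" "?ba \<in> carrier_vec 4" by auto
  have tc: "tensor_vec v w \<in> carrier_vec 16" if "v \<in> carrier_vec 4" "w \<in> carrier_vec 4" for v w
    using tensor_vec_carrier[OF that] by simp
  let ?x = "tensor_vec ?aa ?aa + tensor_vec ?bb ?ba"
  have x: "?x \<in> carrier_vec 16" using aac by (intro add_carrier_vec tc)
  have phi: "tensor_vec ket_phi ket_H0 = ?r \<cdot>\<^sub>v ?x"
    unfolding ket_phi_ghz ghz_def tensor_vec_smult_left
    by (subst tensor_vec_add_left) (simp_all add: tensor_vec_assoc)
  have r: "?r * cnj ?r = 1 / 2" by (simp flip: of_real_mult)
  have step: "decode (parity_pauli t) (pauli_projector 4 ?P t * proj (tensor_vec ket_phi ket_H0) * pauli_projector 4 ?P t) =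
    (1 / 2) \<cdot>\<^sub>m proj ?aa" if t: "t \<in> {1, -1}" for t
  proof -
    let ?y = "tensor_vec ?aa (even_ket t) + tensor_vec ?bb (odd_ket t)"
    have pc: "pauli_projector 4 ?P t \<in> carrier_mat 16 16" using pauli_projector_carrier[OF P] by simp
    have "pauli_projector 4 ?P t *\<^sub>v (?r \<cdot>\<^sub>v ?x) = ?r \<cdot>\<^sub>v ((1 / 2) \<cdot>\<^sub>v tensor_vec ?aa (even_ket t) + (1 / 2) \<cdot>\<^sub>v tensor_vec ?bb (odd_ket t))"
      unfolding mult_mat_vec[OF pc x] mult_add_distrib_mat_vec[OF pc tc[OF aac(1,1)] tc[OF aac(2,3)]]
        pauli_projector_tensor_vec[OF YY_in_paulis aac(1,1)] pauli_projector_tensor_vec[OF YY_in_paulis aac(2,3)]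
        YY_projector_mult[OF t] tensor_vec_smult_right ..
    also have "\<dots> = (?r / 2) \<cdot>\<^sub>v ?y"
      by (intro eq_vecI) (auto simp: field_simps carrier_vecD[OF even_odd_ket_carrier(1)] carrier_vecD[OF even_odd_ket_carrier(2)])
    finally have "pauli_projector 4 ?P t *\<^sub>v tensor_vec ket_phi ket_H0 = (?r / 2) \<cdot>\<^sub>v ?y" unfolding phi .
    then have "pauli_projector 4 ?P t * proj (tensor_vec ket_phi ket_H0) * pauli_projector 4 ?P t = proj ((?r / 2) \<cdot>\<^sub>v ?y)"
      using pauli_projector_conj_proj[OF P t, of "tensor_vec ket_phi ket_H0"] x by (simp add: phi)
    \<comment> \<open>The summands 2 are the squared norms of \<open>even_ket t\<close> and
      \<open>odd_ket t\<close>; the result 1/2 is the probability of the outcome \<open>t\<close> of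
      \<open>YY\<close>.\<close>
    moreover have "?r / 2 * cnj (?r / 2) * (2 + 2) = 1 / 2" using r by simp
    ultimately show ?thesis
      using decode_proj[OF parity_pauli_in_paulis even_odd_ket_carrier parity_pauli_mult_even_ket[OF t] parity_pauli_mult_odd_ket[OF t], of "?r / 2"]
      unfolding cscalar_prod_even_odd_ket[OF t] by simp
  qed
  have "?E (proj (tensor_vec ket_phi ket_H0)) = (1 / 2) \<cdot>\<^sub>m proj ?aa + (1 / 2) \<cdot>\<^sub>m proj ?aa"
    using step by simp
  also have "\<dots> = proj ?aa" by (intro eq_matI) auto
  finally show ?thesis using E unfolding det_converts_def by (intro exI[of _ ?E] conjI)
qed

theorem theorem1:
  shows "\<not> det_converts 3 1 (proj ket_phi) (proj ket_H0) \<and>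
         det_converts 4 2 (proj (tensor_vec ket_phi ket_H0)) (proj (tensor_vec ket_H0 ket_H0))"
  using ket_phi_not_convertible ket_phi_catalysis ..

end
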